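(* Every $K_3$-free graph that is biclique-dominated is biclique $2$-choosable. Furthermore, for any $2$-list assignment $L$ of such a graph, a biclique $L$-coloring can be computed in polynomial time.
   Context: All graphs are finite and simple. A biclique of $G$ is a set $W\subseteq V(G)$ with $G[W]$ complete bipartite $K_{n,m}$ ($n,m\ge1$); a star is a biclique inducing $K_{1,m}$. A maximal biclique is a biclique not properly contained in another biclique. A vertex $w$ false dominates a vertex $v$ (and $v$ is false dominated) if $N(v)\subseteq N(w)$, where $N(\cdot)$ is the open neighborhood. $G$ is biclique-dominated if every maximal biclique of $G$ either is a star or contains a false dominated vertex. A list assignment maps each vertex $v$ to $L(v)\subseteq\mathbb N$; a $2$-list assignment has $|L(v)|=2$. An $L$-coloring is a map $\rho$ with $\rho(v)\in L(v)$; a set is monochromatic if $|\rho(W)|=1$. A biclique $L$-coloring is an $L$-coloring with no monochromatic maximal biclique; $G$ is biclique $k$-choosable if it has a biclique $L$-coloring for every $k$-list assignment $L$. *)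

theory Defs
  imports
    "Graph_Theory.Graph_Theory"
    "HOL-Computational_Algebra.Polynomial"
    "HOL-Library.Log_Nat"
begin

section \<open>Bicliques and biclique colorings\<close>

text \<open>Finite simple graphs are the symmetric loop-free finite digraphs without parallel arcs, i.e.
  the values \<open>G :: 'a pair_pre_digraph\<close> with \<open>pair_graph G\<close>; an undirected edge is a pair of
  opposite arcs.\<close>

definition K3_free :: "'a pair_pre_digraph \<Rightarrow> bool" where
  "K3_free G \<longleftrightarrow> \<not> (\<exists>W \<subseteq> pverts G. K\<^bsub>3\<^esub> (with_proj G \<restriction> W))"

definition biclique :: "'a pair_pre_digraph \<Rightarrow> 'a set \<Rightarrow> bool" where
  "biclique G W \<longleftrightarrow>
     W \<subseteq> pverts G \<and> (\<exists>n m. n \<ge> 1 \<and> m \<ge> 1 \<and> K\<^bsub>n,m\<^esub> (with_proj G \<restriction> W))"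

definition star :: "'a pair_pre_digraph \<Rightarrow> 'a set \<Rightarrow> bool" where
  "star G W \<longleftrightarrow> biclique G W \<and> (\<exists>m. K\<^bsub>1,m\<^esub> (with_proj G \<restriction> W))"

definition maximal_biclique :: "'a pair_pre_digraph \<Rightarrow> 'a set \<Rightarrow> bool" where
  "maximal_biclique G W \<longleftrightarrow> biclique G W \<and> \<not> (\<exists>W'. biclique G W' \<and> W \<subset> W')"

definition nbhd :: "'a pair_pre_digraph \<Rightarrow> 'a \<Rightarrow> 'a set" where
  "nbhd G v = {u. (v, u) \<in> parcs G}"

text \<open>The dominating vertex must be a different one: otherwise every vertex would be false
  dominated, namely by itself.\<close>

definition false_dominates :: "'a pair_pre_digraph \<Rightarrow> 'a \<Rightarrow> 'a \<Rightarrow> bool" where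
  "false_dominates G w v \<longleftrightarrow>
     w \<in> pverts G \<and> v \<in> pverts G \<and> w \<noteq> v \<and> nbhd G v \<subseteq> nbhd G w"

definition false_dominated :: "'a pair_pre_digraph \<Rightarrow> 'a \<Rightarrow> bool" where
  "false_dominated G v \<longleftrightarrow> (\<exists>w. false_dominates G w v)"

definition biclique_dominated :: "'a pair_pre_digraph \<Rightarrow> bool" where
  "biclique_dominated G \<longleftrightarrow>
     (\<forall>W. maximal_biclique G W \<longrightarrow> star G W \<or> (\<exists>v \<in> W. false_dominated G v))"

definition list_assignment :: "nat \<Rightarrow> 'a pair_pre_digraph \<Rightarrow> ('a \<Rightarrow> nat set) \<Rightarrow> bool" where
  "list_assignment k G L \<longleftrightarrow> (\<forall>v \<in> pverts G. finite (L v) \<and> card (L v) = k)"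

definition list_coloring ::
    "'a pair_pre_digraph \<Rightarrow> ('a \<Rightarrow> nat set) \<Rightarrow> ('a \<Rightarrow> nat) \<Rightarrow> bool" where
  "list_coloring G L \<rho> \<longleftrightarrow> (\<forall>v \<in> pverts G. \<rho> v \<in> L v)"

definition monochromatic :: "('a \<Rightarrow> nat) \<Rightarrow> 'a set \<Rightarrow> bool" where
  "monochromatic \<rho> W \<longleftrightarrow> card (\<rho> ` W) = 1"

definition biclique_list_coloring ::
    "'a pair_pre_digraph \<Rightarrow> ('a \<Rightarrow> nat set) \<Rightarrow> ('a \<Rightarrow> nat) \<Rightarrow> bool" where
  "biclique_list_coloring G L \<rho> \<longleftrightarrow>
     list_coloring G L \<rho> \<and> \<not> (\<exists>W. maximal_biclique G W \<and> monochromatic \<rho> W)"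

definition biclique_choosable :: "nat \<Rightarrow> 'a pair_pre_digraph \<Rightarrow> bool" where
  "biclique_choosable k G \<longleftrightarrow>
     (\<forall>L. list_assignment k G L \<longrightarrow> (\<exists>\<rho>. biclique_list_coloring G L \<rho>))"

section \<open>Polynomial time\<close>

text \<open>The model of computation is a random access machine, programmed in a structured language. It
  has registers and an indirectly addressable memory, both holding natural numbers, and its only
  arithmetic operations are addition and truncated subtraction, each of unit cost. As there is no
  multiplication, \<open>t\<close> steps lengthen the numbers by at most \<open>O(t)\<close> bits, and so time polynomial in
  the bit length of the input means the same here as it does for Turing machines.\<close>

datatype aexp =
    Const nat
  | Reg nat
  | Mem aexp
  | Add aexp aexp
  | Sub aexp aexp

datatype bexp =
    Less aexp aexp
  | Eql aexp aexp
  | Neg bexp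
  | Conj bexp bexp

datatype com =
    Skip
  | SetReg nat aexp
  | SetMem aexp aexp
  | Seq com com
  | Cond bexp com com
  | Loop bexp com

record state =
  reg :: "nat \<Rightarrow> nat"
  mem :: "nat \<Rightarrow> nat"

primrec aval :: "aexp \<Rightarrow> state \<Rightarrow> nat" where
  "aval (Const n) s = n"
| "aval (Reg r) s = reg s r"
| "aval (Mem a) s = mem s (aval a s)"
| "aval (Add a b) s = aval a s + aval b s"
| "aval (Sub a b) s = aval a s - aval b s"

primrec bval :: "bexp \<Rightarrow> state \<Rightarrow> bool" where
  "bval (Less a b) s \<longleftrightarrow> aval a s < aval b s"
| "bval (Eql a b) s \<longleftrightarrow> aval a s = aval b s"
| "bval (Neg b) s \<longleftrightarrow> \<not> bval b s"
| "bval (Conj b c) s \<longleftrightarrow> bval b s \<and> bval c s"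

primrec acost :: "aexp \<Rightarrow> nat" where
  "acost (Const n) = 1"
| "acost (Reg r) = 1"
| "acost (Mem a) = 1 + acost a"
| "acost (Add a b) = 1 + acost a + acost b"
| "acost (Sub a b) = 1 + acost a + acost b"

primrec bcost :: "bexp \<Rightarrow> nat" where
  "bcost (Less a b) = 1 + acost a + acost b"
| "bcost (Eql a b) = 1 + acost a + acost b"
| "bcost (Neg b) = 1 + bcost b"
| "bcost (Conj b c) = 1 + bcost b + bcost c"

text \<open>\<open>exec c s t s'\<close>: started in state \<open>s\<close>, the program \<open>c\<close> halts in state \<open>s'\<close> after exactly
  \<open>t\<close> time units.\<close>

inductive exec :: "com \<Rightarrow> state \<Rightarrow> nat \<Rightarrow> state \<Rightarrow> bool" where
  Skip: "exec Skip s 1 s"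
| SetReg: "exec (SetReg r a) s (1 + acost a) (s\<lparr>reg := (reg s)(r := aval a s)\<rparr>)"
| SetMem: "exec (SetMem a b) s (1 + acost a + acost b)
             (s\<lparr>mem := (mem s)(aval a s := aval b s)\<rparr>)"
| Seq: "exec c s t s' \<Longrightarrow> exec d s' u s'' \<Longrightarrow> exec (Seq c d) s (t + u) s''"
| CondTrue: "bval b s \<Longrightarrow> exec c s t s' \<Longrightarrow> exec (Cond b c d) s (1 + bcost b + t) s'"
| CondFalse: "\<not> bval b s \<Longrightarrow> exec d s t s' \<Longrightarrow> exec (Cond b c d) s (1 + bcost b + t) s'"
| LoopFalse: "\<not> bval b s \<Longrightarrow> exec (Loop b c) s (1 + bcost b) s"
| LoopTrue: "bval b s \<Longrightarrow> exec c s t s' \<Longrightarrow> exec (Loop b c) s' u s'' \<Longrightarrow>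
             exec (Loop b c) s (1 + bcost b + t + u) s''"

inductive_cases exec_SkipE: "exec Skip s t s'"
  and exec_SetRegE: "exec (SetReg r a) s t s'"
  and exec_SetMemE: "exec (SetMem a b) s t s'"
  and exec_SeqE: "exec (Seq c d) s t s'"
  and exec_CondE: "exec (Cond b c d) s t s'"
  and exec_LoopE: "exec (Loop b c) s t s'"

lemma exec_deterministic:
  "exec c s t s' \<Longrightarrow> exec c s u s'' \<Longrightarrow> u = t \<and> s'' = s'"
proof (induction arbitrary: u s'' rule: exec.induct)
  case (Seq c s t s' d u' s3)
  from Seq.prems obtain t1 u1 s1
    where "exec c s t1 s1" "exec d s1 u1 s''" "u = t1 + u1"
    by (rule exec_SeqE)
  with Seq.IH(1)[of t1 s1] Seq.IH(2)[of u1 s''] show ?case by simp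
next
  case (CondTrue b s c t s' d)
  from CondTrue.prems CondTrue.hyps(1) obtain t1 where "exec c s t1 s''" "u = 1 + bcost b + t1"
    by (auto elim: exec_CondE)
  with CondTrue.IH[of t1 s''] show ?case by simp
next
  case (CondFalse b s d t s' c)
  from CondFalse.prems CondFalse.hyps(1) obtain t1 where "exec d s t1 s''" "u = 1 + bcost b + t1"
    by (auto elim: exec_CondE)
  with CondFalse.IH[of t1 s''] show ?case by simp
next
  case (LoopFalse b s c)
  from LoopFalse.prems LoopFalse.hyps show ?case by (auto elim: exec_LoopE)
next
  case (LoopTrue b s c t s' u' s3)
  from LoopTrue.prems LoopTrue.hyps(1) obtain t1 u1 s1
    where "exec c s t1 s1" "exec (Loop b c) s1 u1 s''" "u = 1 + bcost b + t1 + u1"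
    by (auto elim: exec_LoopE)
  with LoopTrue.IH(1)[of t1 s1] LoopTrue.IH(2)[of u1 s''] show ?case by simp
qed (auto elim: exec_SkipE exec_SetRegE exec_SetMemE)

text \<open>A list of numbers is passed as a block of memory, with its length in register 0 and its start
  address in register 1; the input block starts at address 0. All other cells hold 0 initially.\<close>

definition initial_state :: "nat list \<Rightarrow> state" where
  "initial_state xs =
     \<lparr>reg = (\<lambda>_. 0)(0 := length xs),
      mem = (\<lambda>i. if i < length xs then xs ! i else 0)\<rparr>"

definition result :: "state \<Rightarrow> nat list" where
  "result s = map (mem s) [reg s 1 ..< reg s 1 + reg s 0]"

definition bit_size :: "nat list \<Rightarrow> nat" where
  "bit_size xs = (\<Sum>x\<leftarrow>xs. 1 + floorlog 2 x)"

text \<open>One program has to find, for every instance \<open>x \<in> I\<close> presented as the word \<open>enc x\<close>, some \<open>ys\<close>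
  with \<open>sol x ys\<close>, in time polynomial in the bit length of \<open>enc x\<close>. The length of the result is
  charged as well, since otherwise a result of exponential length could be announced in polynomial
  time by doubling register 0.\<close>

definition poly_time_solvable ::
    "('i \<Rightarrow> nat list) \<Rightarrow> 'i set \<Rightarrow> ('i \<Rightarrow> nat list \<Rightarrow> bool) \<Rightarrow> bool" where
  "poly_time_solvable enc I sol \<longleftrightarrow>
     (\<exists>(c :: com) (q :: nat poly). \<forall>x \<in> I. \<exists>t s.
        exec c (initial_state (enc x)) t s \<and>
        t + length (result s) \<le> poly q (bit_size (enc x)) \<and>
        sol x (result s))"

text \<open>A graph on the vertices \<open>0, \<dots>, n - 1\<close> with a list assignment is presented as \<open>n\<close>, followed by
  the rows of the adjacency matrix, followed by the color lists (each in increasing order) of the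
  vertices \<open>0, \<dots>, n - 1\<close>.\<close>

definition encode_instance :: "nat pair_pre_digraph \<times> (nat \<Rightarrow> nat set) \<Rightarrow> nat list" where
  "encode_instance = (\<lambda>(G, L). let n = card (pverts G) in
     n # concat (map (\<lambda>i. map (\<lambda>j. if (i, j) \<in> parcs G then 1 else 0) [0..<n]) [0..<n])
       @ concat (map (\<lambda>i. sorted_list_of_set (L i)) [0..<n]))"

text \<open>Position \<open>v\<close> of the result holds the color of the vertex \<open>v\<close>.\<close>

definition encodes_biclique_list_coloring ::
    "nat pair_pre_digraph \<times> (nat \<Rightarrow> nat set) \<Rightarrow> nat list \<Rightarrow> bool" where
  "encodes_biclique_list_coloring = (\<lambda>(G, L) ys.
     length ys = card (pverts G) \<and> biclique_list_coloring G L (\<lambda>v. ys ! v))"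

end

theory Submission
  imports Defs
begin

text \<open>Call a vertex dominated if another vertex has a strictly larger neighborhood, or the same
  neighborhood and a smaller rank; the remaining vertices form the core. Domination is transitive, so every
  dominated vertex has a dominator in the core, and in a triangle-free graph a maximal biclique
  contains the dominators of its vertices. Hence a coloring in which each dominated vertex differs
  from one of its dominators can only fail on maximal bicliques inside the core. Such a biclique has
  no false dominated vertex, so it is a star, namely a core vertex together with its whole
  neighborhood. It therefore suffices that each core vertex with a neighbor in the core has a
  differently colored one. This is achieved greedily: when an edge of the core with an unvisited end
  is met, that end receives a color different from the other end and both are visited.\<close>

section \<open>Bicliques in triangle-free graphs\<close>

text \<open>Exhibits an induced subgraph as the projection of a pair digraph, the form in which
  \<open>complete_digraph_pair_def\<close> and \<open>complete_bipartite_digraph_pair_def\<close>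
  apply.\<close>

lemma induce_subgraph_with_proj:
  "with_proj G \<restriction> W = with_proj \<lparr>pverts = W, parcs = parcs G \<inter> W \<times> W\<rparr>"
  by (auto simp: induce_subgraph_def with_proj_def)

lemma pair_graph_arcD:
  assumes "pair_graph G" "(u, v) \<in> parcs G"
  shows "u \<in> pverts G" "v \<in> pverts G" "(v, u) \<in> parcs G" "u \<noteq> v"
proof -
  interpret pair_graph G by fact
  show "u \<in> pverts G" "v \<in> pverts G" using assms(2) by (auto dest: in_arcsD1 in_arcsD2)
  show "(v, u) \<in> parcs G" using assms(2) by (rule arcs_symmetric)
  show "u \<noteq> v" using assms(2) no_loops' by blast
qed

text \<open>Three pairwise adjacent vertices are distinct because there are no loops, so they would
  induce a \<open>K_3\<close>.\<close>

lemma K3_free_no_triangle: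
  assumes "pair_graph G" "K3_free G" "(x, y) \<in> parcs G" "(y, z) \<in> parcs G"
  shows "(x, z) \<notin> parcs G"
proof
  assume xz: "(x, z) \<in> parcs G"
  note D = pair_graph_arcD[OF assms(1)]
  have "card {x, y, z} = 3" using D(4)[OF assms(3)] D(4)[OF assms(4)] D(4)[OF xz] by simp
  moreover have "parcs G \<inter> {x, y, z} \<times> {x, y, z} = {(u, v). (u, v) \<in> {x, y, z} \<times> {x, y, z} \<and> u \<noteq> v}"
    using D(3)[OF assms(3)] D(3)[OF assms(4)] D(3)[OF xz] D(4) assms(3,4) xz by blast
  ultimately have "K\<^bsub>3\<^esub> (with_proj G \<restriction> {x, y, z})"
    unfolding induce_subgraph_with_proj complete_digraph_pair_def by simp
  moreover have "{x, y, z} \<subseteq> pverts G" using D(1,2) assms(3,4) by auto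
  ultimately show False using assms(2) unfolding K3_free_def by blast
qed

text \<open>Keeps the two sides as explicit sets. The equation for the arcs states both completeness
  between the sides and independence within each.\<close>

definition biclique_parts :: "'a pair_pre_digraph \<Rightarrow> 'a set \<Rightarrow> 'a set \<Rightarrow> bool" where
  "biclique_parts G A B \<longleftrightarrow> A \<noteq> {} \<and> B \<noteq> {} \<and> A \<inter> B = {} \<and> A \<union> B \<subseteq> pverts G \<and>
     parcs G \<inter> (A \<union> B) \<times> (A \<union> B) = A \<times> B \<union> B \<times> A"

lemma biclique_parts_commute: "biclique_parts G A B \<longleftrightarrow> biclique_parts G B A"
  unfolding biclique_parts_def by (auto simp: Un_commute Int_commute)

lemma biclique_iff_parts:
  assumes "pair_graph G"
  shows "biclique G W \<longleftrightarrow> (\<exists>A B. W = A \<union> B \<and> biclique_parts G A B)"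
proof -
  interpret pair_graph G by fact
  have fin: "finite W" if "W \<subseteq> pverts G" for W using that finite_verts finite_subset by blast
  show ?thesis
  proof
    assume "biclique G W"
    then obtain n m A B where *: "W \<subseteq> pverts G" "n \<ge> 1" "m \<ge> 1" "W = A \<union> B" "A \<inter> B = {}"
      "card A = n" "card B = m" "parcs G \<inter> W \<times> W = A \<times> B \<union> B \<times> A"
      unfolding biclique_def induce_subgraph_with_proj complete_bipartite_digraph_pair_def by auto
    then have "A \<noteq> {}" "B \<noteq> {}" by auto
    with * show "\<exists>A B. W = A \<union> B \<and> biclique_parts G A B" unfolding biclique_parts_def by blast
  next
    assume "\<exists>A B. W = A \<union> B \<and> biclique_parts G A B"
    then obtain A B where AB: "W = A \<union> B" "biclique_parts G A B" by blast
    then have W: "W \<subseteq> pverts G" unfolding biclique_parts_def by blast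
    have "finite A" "finite B" using fin[OF W] AB(1) by auto
    then have "card A \<ge> 1" "card B \<ge> 1"
      using AB(2) unfolding biclique_parts_def by (simp_all add: Suc_le_eq card_gt_0_iff)
    moreover have "K\<^bsub>card A,card B\<^esub> (with_proj G \<restriction> W)"
      unfolding induce_subgraph_with_proj complete_bipartite_digraph_pair_def
      using fin[OF W] AB unfolding biclique_parts_def by auto
    ultimately show "biclique G W" using W unfolding biclique_def by blast
  qed
qed

lemma star_parts:
  assumes "pair_graph G" "star G W"
  obtains v B where "W = {v} \<union> B" "biclique_parts G {v} B"
proof -
  obtain m where bi: "biclique G W" and "K\<^bsub>1,m\<^esub> (with_proj G \<restriction> W)"
    using assms(2) unfolding star_def by blast
  then obtain A B where W: "W = A \<union> B" "A \<inter> B = {}" "card A = 1"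
      "parcs G \<inter> W \<times> W = A \<times> B \<union> B \<times> A"
    unfolding induce_subgraph_with_proj complete_bipartite_digraph_pair_def by auto
  obtain v where v: "A = {v}" using W(3) card_1_singletonE by blast
  obtain A' B' where AB': "W = A' \<union> B'" "biclique_parts G A' B'"
    using bi biclique_iff_parts[OF assms(1)] by blast
  \<comment> \<open>The formula for \<open>K_{1,m}\<close> alone would admit \<open>m = 0\<close>.
    As a biclique, \<open>W\<close> contains an arc, which forces \<open>B\<close> to be
    nonempty.\<close>
  then have "parcs G \<inter> W \<times> W \<noteq> {}" "W \<subseteq> pverts G" unfolding biclique_parts_def by auto
  then have "biclique_parts G {v} B" using W v unfolding biclique_parts_def by auto
  then show ?thesis using that W(1) v by blast
qed

text \<open>By triangle-freeness a vertex adjacent to all of \<open>B\<close> has no neighbor in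
  \<open>A\<close>, so if it lay outside it could be added to the side \<open>A\<close>, against
  maximality.\<close>

lemma maximal_biclique_closed:
  assumes G: "pair_graph G" "K3_free G" and max: "maximal_biclique G (A \<union> B)"
    and parts: "biclique_parts G A B" and w: "w \<in> pverts G" "B \<subseteq> nbhd G w"
  shows "w \<in> A \<union> B"
proof (rule ccontr)
  assume nw: "w \<notin> A \<union> B"
  note D = pair_graph_arcD[OF G(1)]
  have AB: "A \<noteq> {}" "B \<noteq> {}" "A \<inter> B = {}" "A \<union> B \<subseteq> pverts G"
    "parcs G \<inter> (A \<union> B) \<times> (A \<union> B) = A \<times> B \<union> B \<times> A"
    using parts unfolding biclique_parts_def by auto
  have wB: "(w, b) \<in> parcs G" "(b, w) \<in> parcs G" if "b \<in> B" for b
    using that w(2) D(3) unfolding nbhd_def by auto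
  have wA: "(w, a) \<notin> parcs G \<and> (a, w) \<notin> parcs G" if "a \<in> A" for a
  proof -
    obtain b where b: "b \<in> B" using AB(2) by blast
    then have "(b, a) \<in> parcs G" using AB(5) that by blast
    then have "(w, a) \<notin> parcs G" using K3_free_no_triangle[OF G wB(1)[OF b]] by blast
    then show ?thesis using D(3) by blast
  qed
  have ww: "(w, w) \<notin> parcs G" using D(4) by blast
  have "parcs G \<inter> (insert w A \<union> B) \<times> (insert w A \<union> B) = insert w A \<times> B \<union> B \<times> insert w A"
    using wB wA ww AB(5) by blast
  then have "biclique_parts G (insert w A) B"
    using AB nw w(1) unfolding biclique_parts_def by auto
  then have "biclique G (insert w A \<union> B)" using biclique_iff_parts[OF G(1)] by blast
  moreover have "A \<union> B \<subset> insert w A \<union> B" using nw by blast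
  ultimately show False using max unfolding maximal_biclique_def by blast
qed

text \<open>The side opposite to \<open>v\<close> lies in the neighborhood of \<open>v\<close>,
  hence in that of \<open>w\<close>, so \<open>maximal_biclique_closed\<close> applies.\<close>

lemma maximal_biclique_dominator:
  assumes G: "pair_graph G" "K3_free G" and max: "maximal_biclique G W"
    and v: "v \<in> W" and w: "w \<in> pverts G" "nbhd G v \<subseteq> nbhd G w"
  shows "w \<in> W"
proof -
  obtain A B where AB: "W = A \<union> B" "biclique_parts G A B" "v \<in> A"
  proof -
    obtain A B where "W = A \<union> B" "biclique_parts G A B"
      using max biclique_iff_parts[OF G(1), of W] unfolding maximal_biclique_def by blast
    then have "(W = A \<union> B \<and> biclique_parts G A B \<and> v \<in> A) \<or>
        (W = B \<union> A \<and> biclique_parts G B A \<and> v \<in> B)"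
      using v biclique_parts_commute[of G A B] Un_commute[of A B] by (metis UnE)
    then show ?thesis using that by metis
  qed
  then have "B \<subseteq> nbhd G v" unfolding biclique_parts_def nbhd_def by blast
  then show ?thesis using maximal_biclique_closed[OF G _ AB(2) w(1)] max AB(1) w(2) by blast
qed

text \<open>A neighbor of the center is adjacent to the whole side \<open>{v}\<close>, so this is
  \<open>maximal_biclique_closed\<close> with the sides exchanged.\<close>

lemma maximal_star_contains_nbhd:
  assumes G: "pair_graph G" "K3_free G" and max: "maximal_biclique G ({v} \<union> B)"
    and parts: "biclique_parts G {v} B" and u: "(v, u) \<in> parcs G"
  shows "u \<in> {v} \<union> B"
proof -
  note D = pair_graph_arcD[OF G(1) u]
  have "{v} \<subseteq> nbhd G u" using D(3) unfolding nbhd_def by simp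
  then show ?thesis
    using maximal_biclique_closed[OF G _ _ D(2), of B "{v}"] max parts biclique_parts_commute
    by (metis Un_commute)
qed

section \<open>Core vertices\<close>

text \<open>Ties between false twins are broken by an injective rank, so that each class of twins keeps
  at most one core vertex.\<close>

definition rdom :: "'a pair_pre_digraph \<Rightarrow> ('a \<Rightarrow> nat) \<Rightarrow> 'a \<Rightarrow> 'a \<Rightarrow> bool" where
  "rdom G r v w \<longleftrightarrow>
     v \<in> pverts G \<and> w \<in> pverts G \<and> v \<noteq> w \<and> nbhd G v \<subseteq> nbhd G w \<and>
     (nbhd G w \<subseteq> nbhd G v \<longrightarrow> r w < r v)"

definition core :: "'a pair_pre_digraph \<Rightarrow> ('a \<Rightarrow> nat) \<Rightarrow> 'a set" where
  "core G r = {v \<in> pverts G. \<not> (\<exists>w. rdom G r v w)}"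

text \<open>If \<open>nbhd G w\<close> is contained in \<open>nbhd G u\<close>, all three
  neighborhoods coincide and the rank drops twice; this also excludes \<open>u = w\<close>.\<close>

lemma rdom_trans:
  assumes "rdom G r u v" "rdom G r v w" shows "rdom G r u w"
  using assms unfolding rdom_def by fastforce

text \<open>As \<open>rdom\<close> is transitive and irreflexive on a finite set, its converse is
  well founded, and climbing from \<open>v\<close> ends in the core.\<close>

lemma core_dominator_exists:
  assumes "pair_graph G" "v \<in> pverts G" "v \<notin> core G r"
  obtains w where "w \<in> core G r" "rdom G r v w"
proof -
  interpret pair_graph G by fact
  let ?R = "{(w, v). rdom G r v w}"
  have "?R \<subseteq> pverts G \<times> pverts G" unfolding rdom_def by auto
  then have "finite ?R" using finite_verts finite_subset by blast
  moreover have "trans ?R" by (auto intro: transI rdom_trans)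
  then have "acyclic ?R" unfolding acyclic_def by (auto simp: trancl_id rdom_def)
  ultimately have "wf ?R" by (rule finite_acyclic_wf)
  \<comment> \<open>Including \<open>v\<close> itself makes the set nonempty. A minimal
    \<open>w\<close> has no dominator by transitivity, and \<open>v \<notin> core G r\<close>
    finally rules out \<open>w = v\<close>.\<close>
  moreover have "v \<in> {w. rdom G r v w \<or> w = v}" by simp
  ultimately obtain w where w: "rdom G r v w \<or> w = v" "\<And>u. (u, w) \<in> ?R \<Longrightarrow> \<not> (rdom G r v u \<or> u = v)"
    unfolding wf_eq_minimal by (metis (mono_tags, lifting) mem_Collect_eq)
  have "\<not> rdom G r w u" for u
  proof
    assume wu: "rdom G r w u"
    then have "rdom G r v u" using w(1) rdom_trans[of G r v w u] by auto
    then show False using w(2)[of u] wu by simp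
  qed
  then have "w \<in> core G r" using w(1) assms(2) unfolding core_def rdom_def by auto
  then show ?thesis using that w(1) assms(3) by blast
qed

lemma biclique_list_coloringI:
  assumes G: "pair_graph G" "K3_free G" "biclique_dominated G" and r: "inj_on r (pverts G)"
    and list: "list_coloring G L c"
    and outside: "\<And>v. v \<in> pverts G \<Longrightarrow> v \<notin> core G r \<Longrightarrow> \<exists>w. rdom G r v w \<and> c v \<noteq> c w"
    and inside: "\<And>u v. u \<in> core G r \<Longrightarrow> v \<in> core G r \<Longrightarrow> (v, u) \<in> parcs G \<Longrightarrow>
      \<exists>w. (v, w) \<in> parcs G \<and> c v \<noteq> c w"
  shows "biclique_list_coloring G L c"
proof -
  have False if max: "maximal_biclique G W" and mono: "monochromatic c W" for W
  proof -
    have eq: "c x = c y" if "x \<in> W" "y \<in> W" for x y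
    proof -
      obtain k where "c ` W = {k}" using mono unfolding monochromatic_def
        by (rule card_1_singletonE)
      then show ?thesis using that by (metis imageI singletonD)
    qed
    have WV: "W \<subseteq> pverts G" using max unfolding maximal_biclique_def biclique_def by blast
    have W: "W \<subseteq> core G r"
    proof
      fix v assume v: "v \<in> W"
      show "v \<in> core G r"
      proof (rule ccontr)
        assume "v \<notin> core G r"
        then obtain w where w: "rdom G r v w" "c v \<noteq> c w" using outside v WV by blast
        then have "w \<in> W" using maximal_biclique_dominator[OF G(1,2) max v] unfolding rdom_def by blast
        then show False using w eq v by blast
      qed
    qed
    have "\<not> false_dominated G v" if v: "v \<in> W" for v
    proof
      assume "false_dominated G v"
      then obtain w where w: "w \<in> pverts G" "v \<in> pverts G" "w \<noteq> v" "nbhd G v \<subseteq> nbhd G w"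
        unfolding false_dominated_def false_dominates_def by blast
      have "w \<in> W" using maximal_biclique_dominator[OF G(1,2) max v w(1,4)] .
      \<comment> \<open>Both vertices are in the core, so neither dominates the other. With
        \<open>nbhd G v \<subseteq> nbhd G w\<close> this leaves only equal neighborhoods and equal
        ranks, which injectivity of \<open>r\<close> forbids.\<close>
      then have "\<not> rdom G r v w" "\<not> rdom G r w v" using W v unfolding core_def by blast+
      moreover have "r v \<noteq> r w" using r w unfolding inj_on_def by blast
      ultimately show False using w unfolding rdom_def by auto
    qed
    then have "star G W" using G(3) max unfolding biclique_dominated_def by blast
    then obtain v B where vB: "W = {v} \<union> B" "biclique_parts G {v} B" using star_parts[OF G(1)] by blast
    \<comment> \<open>Any leaf \<open>u\<close> is a core neighbor of the center, so
      \<open>inside\<close> applies. The differently colored \<open>w\<close> it yields is again in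
      \<open>W\<close>, since the star contains every neighbor of its center.\<close>
    then obtain u where "u \<in> B" "(v, u) \<in> parcs G" unfolding biclique_parts_def by blast
    then obtain w where w: "(v, w) \<in> parcs G" "c v \<noteq> c w" using inside[of u v] W vB(1) by blast
    have "w \<in> W" using maximal_star_contains_nbhd[OF G(1,2) _ vB(2) w(1)] max vB(1) by blast
    then show False using w(2) eq vB(1) by blast
  qed
  then show ?thesis using list unfolding biclique_list_coloring_def by blast
qed

section \<open>The coloring procedure\<close>

text \<open>\<open>e v = 0\<close> means that \<open>v\<close> has not been visited yet; a visited vertex has a visited core
  neighbor of a different color, and neither of the two is ever recolored.\<close>

definition core_inv ::
    "'a pair_pre_digraph \<Rightarrow> ('a \<Rightarrow> nat) \<Rightarrow> ('a \<Rightarrow> nat) \<Rightarrow> ('a \<Rightarrow> nat) \<Rightarrow>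
     ('a \<times> 'a) set \<Rightarrow> ('a \<Rightarrow> nat) \<Rightarrow> ('a \<Rightarrow> nat) \<Rightarrow> bool" where
  "core_inv G r f g S c e \<longleftrightarrow>
     (\<forall>v \<in> pverts G. c v \<in> {f v, g v}) \<and>
     (\<forall>v \<in> pverts G. e v = 0 \<longrightarrow> c v = f v) \<and>
     (\<forall>v \<in> pverts G. e v \<noteq> 0 \<longrightarrow> (\<exists>u \<in> core G r. (v, u) \<in> parcs G \<and> e u \<noteq> 0 \<and> c v \<noteq> c u)) \<and>
     (\<forall>(i, j) \<in> S. (i, j) \<in> parcs G \<and> i \<in> core G r \<and> j \<in> core G r \<longrightarrow> e j \<noteq> 0)"

lemma core_inv_init: "core_inv G r f g {} f (\<lambda>_. 0)"
  unfolding core_inv_def by simp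

text \<open>An unvisited \<open>j\<close> still carries \<open>f j\<close>, so in a conflict
  \<open>g j\<close> differs from \<open>c i\<close>. Witnesses are visited vertices, so no visited
  vertex relies on \<open>j\<close> and recoloring it breaks nothing.\<close>

lemma core_inv_step:
  assumes G: "pair_graph G" and fg: "\<And>v. v \<in> pverts G \<Longrightarrow> f v \<noteq> g v"
    and inv: "core_inv G r f g S c e"
    and active: "(i, j) \<in> parcs G" "e j = 0" "i \<in> core G r" "j \<in> core G r"
  shows "core_inv G r f g (insert (i, j) S) (c(j := if c j = c i then g j else c j)) (e(i := 1, j := 1))"
    (is "core_inv G r f g _ ?c ?e")
proof -
  note D = pair_graph_arcD[OF G active(1)]
  have I: "\<And>v. v \<in> pverts G \<Longrightarrow> c v \<in> {f v, g v}"
    "\<And>v. v \<in> pverts G \<Longrightarrow> e v = 0 \<Longrightarrow> c v = f v"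
    "\<And>v. v \<in> pverts G \<Longrightarrow> e v \<noteq> 0 \<Longrightarrow> \<exists>u \<in> core G r. (v, u) \<in> parcs G \<and> e u \<noteq> 0 \<and> c v \<noteq> c u"
    "\<forall>(i, j) \<in> S. (i, j) \<in> parcs G \<and> i \<in> core G r \<and> j \<in> core G r \<longrightarrow> e j \<noteq> 0"
    using inv unfolding core_inv_def by auto
  have ji: "?c j \<noteq> ?c i" using I(2)[of j] fg[of j] D active(2) by auto
  have "\<exists>u \<in> core G r. (v, u) \<in> parcs G \<and> ?e u \<noteq> 0 \<and> ?c v \<noteq> ?c u" if v: "v \<in> pverts G" "?e v \<noteq> 0" for v
  proof (cases "v = i \<or> v = j")
    case True
    then show ?thesis
    proof
      assume "v = i" then show ?thesis using active(1,4) ji by (intro bexI[of _ j]) auto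
    next
      assume "v = j" then show ?thesis using D(3,4) active(3) ji by (intro bexI[of _ i]) auto
    qed
  next
    case False
    then obtain u where "u \<in> core G r" "(v, u) \<in> parcs G" "e u \<noteq> 0" "c v \<noteq> c u" using I(3)[of v] v by auto
    then show ?thesis using active(2) False by (intro bexI[of _ u]) auto
  qed
  then show ?thesis using I(1,2,4) unfolding core_inv_def by auto
qed

lemma core_inv_skip:
  assumes "core_inv G r f g S c e"
    and "\<not> ((i, j) \<in> parcs G \<and> i \<in> core G r \<and> j \<in> core G r \<and> e j = 0)"
  shows "core_inv G r f g (insert (i, j) S) c e"
  using assms unfolding core_inv_def by auto

text \<open>\<open>S\<close> collects the scanned pairs, and colors on the core are frozen at
  \<open>c0\<close>. The witness \<open>w\<close> need not be the scanned \<open>j\<close>, because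
  a later pair with the same \<open>i\<close> may recolor \<open>i\<close> against another
  dominator.\<close>

definition outer_inv ::
    "'a pair_pre_digraph \<Rightarrow> ('a \<Rightarrow> nat) \<Rightarrow> ('a \<Rightarrow> nat) \<Rightarrow> ('a \<Rightarrow> nat) \<Rightarrow> ('a \<Rightarrow> nat) \<Rightarrow>
     ('a \<times> 'a) set \<Rightarrow> ('a \<Rightarrow> nat) \<Rightarrow> bool" where
  "outer_inv G r f g c0 S c \<longleftrightarrow>
     (\<forall>v \<in> pverts G. c v \<in> {f v, g v}) \<and>
     (\<forall>v \<in> core G r. c v = c0 v) \<and>
     (\<forall>(i, j) \<in> S. j \<in> core G r \<and> rdom G r i j \<longrightarrow>
        (\<exists>w \<in> core G r. rdom G r i w \<and> c i \<noteq> c w))"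

lemma outer_inv_init:
  assumes "\<forall>v \<in> pverts G. c v \<in> {f v, g v}" shows "outer_inv G r f g c {} c"
  using assms unfolding outer_inv_def by simp

lemma outer_inv_step:
  assumes fg: "\<And>v. v \<in> pverts G \<Longrightarrow> f v \<noteq> g v" and inv: "outer_inv G r f g c0 S c"
    and active: "j \<in> core G r" "rdom G r i j"
  shows "outer_inv G r f g c0 (insert (i, j) S) (c(i := if c j = f i then g i else f i))"
proof -
  have "i \<notin> core G r" "i \<in> pverts G" "i \<noteq> j"
    using active(2) unfolding core_def rdom_def by blast+
  then show ?thesis using inv active fg[of i] unfolding outer_inv_def by fastforce
qed

lemma outer_inv_skip:
  assumes "outer_inv G r f g c0 S c" "\<not> (j \<in> core G r \<and> rdom G r i j)"
  shows "outer_inv G r f g c0 (insert (i, j) S) c"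
  using assms unfolding outer_inv_def by auto

lemma biclique_list_coloring_from_invs:
  assumes G: "pair_graph G" "K3_free G" "biclique_dominated G" and r: "inj_on r (pverts G)"
    and L: "\<And>v. v \<in> pverts G \<Longrightarrow> L v = {f v, g v}"
    and inv0: "core_inv G r f g (pverts G \<times> pverts G) c0 e"
    and inv: "outer_inv G r f g c0 (pverts G \<times> pverts G) c"
  shows "biclique_list_coloring G L c"
proof (rule biclique_list_coloringI[OF G r])
  show "list_coloring G L c" using inv L unfolding outer_inv_def list_coloring_def by auto
next
  fix v assume v: "v \<in> pverts G" "v \<notin> core G r"
  then obtain w where w: "w \<in> core G r" "rdom G r v w" using core_dominator_exists[OF G(1)] by blast
  then have "(v, w) \<in> pverts G \<times> pverts G" unfolding rdom_def by blast
  then show "\<exists>w. rdom G r v w \<and> c v \<noteq> c w" using inv w unfolding outer_inv_def by blast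
next
  fix u v assume uv: "u \<in> core G r" "v \<in> core G r" "(v, u) \<in> parcs G"
  then have arc: "(u, v) \<in> parcs G" "u \<in> pverts G" "v \<in> pverts G"
    using pair_graph_arcD[OF G(1)] by blast+
  \<comment> \<open>The scanned-pairs clause of \<open>core_inv\<close> speaks of the second
    component, which is why the arc was reversed to \<open>(u, v)\<close>.\<close>
  then have "e v \<noteq> 0" using inv0 uv unfolding core_inv_def by fast
  then obtain w where "w \<in> core G r" "(v, w) \<in> parcs G" "c0 v \<noteq> c0 w"
    using inv0 arc(3) unfolding core_inv_def by blast
  \<comment> \<open>Both \<open>v\<close> and \<open>w\<close> are in the core, where
    \<open>c\<close> agrees with \<open>c0\<close>.\<close>
  then show "\<exists>w. (v, w) \<in> parcs G \<and> c v \<noteq> c w"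
    using inv uv(2) unfolding outer_inv_def by auto
qed

section \<open>Existence of the coloring and 2-choosability\<close>

text \<open>The invariant steps accept pairs in any order, so induction over a finite set of pairs
  replaces the loop.\<close>

lemma core_inv_exists:
  assumes G: "pair_graph G" and fg: "\<And>v. v \<in> pverts G \<Longrightarrow> f v \<noteq> g v" and "finite S"
  shows "\<exists>c e. core_inv G r f g S c e"
  using \<open>finite S\<close>
proof (induction S rule: finite_induct)
  case empty
  then show ?case using core_inv_init by blast
next
  case (insert x S)
  obtain i j where x: "x = (i, j)" by (cases x)
  obtain c e where inv: "core_inv G r f g S c e" using insert.IH by blast
  show ?case
  proof (cases "(i, j) \<in> parcs G \<and> i \<in> core G r \<and> j \<in> core G r \<and> e j = 0")
    case True
    then show ?thesis using core_inv_step[OF G fg inv, of i j] x by blast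
  next
    case False
    then show ?thesis using core_inv_skip[OF inv False] x by blast
  qed
qed

lemma outer_inv_exists:
  assumes fg: "\<And>v. v \<in> pverts G \<Longrightarrow> f v \<noteq> g v" and c0: "\<forall>v \<in> pverts G. c0 v \<in> {f v, g v}" and "finite S"
  shows "\<exists>c. outer_inv G r f g c0 S c"
  using \<open>finite S\<close>
proof (induction S rule: finite_induct)
  case empty
  then show ?case using outer_inv_init[OF c0] by blast
next
  case (insert x S)
  obtain i j where x: "x = (i, j)" by (cases x)
  obtain c where inv: "outer_inv G r f g c0 S c" using insert.IH by blast
  show ?case
  proof (cases "j \<in> core G r \<and> rdom G r i j")
    case True
    then show ?thesis using outer_inv_step[OF fg inv, of j i] x by blast
  next
    case False
    then show ?thesis using outer_inv_skip[OF inv False] x by blast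
  qed
qed

text \<open>Choosing minimum and maximum as first and second color matches the increasing order in
  which the encoding lists the colors.\<close>

lemma list_assignment_2_pair:
  assumes "list_assignment 2 G L" "v \<in> pverts G"
  shows "L v = {Min (L v), Max (L v)}" "Min (L v) < Max (L v)"
proof -
  obtain x y where xy: "L v = {x, y}" "x \<noteq> y"
    using assms unfolding list_assignment_def by (auto simp: card_2_iff)
  then show "L v = {Min (L v), Max (L v)}" "Min (L v) < Max (L v)" by (auto simp: min_def max_def)
qed

lemma biclique_dominated_choosable:
  assumes G: "pair_graph G" "K3_free G" "biclique_dominated G"
  shows "biclique_choosable 2 G"
  unfolding biclique_choosable_def
proof (intro allI impI)
  fix L :: "'a \<Rightarrow> nat set"
  assume "list_assignment 2 G L"
  note L = list_assignment_2_pair[OF this]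
  let ?f = "\<lambda>v. Min (L v)" and ?g = "\<lambda>v. Max (L v)"
  interpret pair_graph G by fact
  have fg: "?f v \<noteq> ?g v" if "v \<in> pverts G" for v using L(2)[OF that] by simp
  have fin: "finite (pverts G \<times> pverts G)" using finite_verts by blast
  \<comment> \<open>The vertex type need not be ordered, so the rank is any injection of the finite
    vertex set into the naturals.\<close>
  obtain r :: "'a \<Rightarrow> nat" where r: "inj_on r (pverts G)"
    using finite_imp_inj_to_nat_seg[OF finite_verts] by blast
  obtain c0 e where inv0: "core_inv G r ?f ?g (pverts G \<times> pverts G) c0 e"
    using core_inv_exists[of G ?f ?g, OF G(1) fg fin] by blast
  then have "\<forall>v \<in> pverts G. c0 v \<in> {?f v, ?g v}" unfolding core_inv_def by blast
  then obtain c where "outer_inv G r ?f ?g c0 (pverts G \<times> pverts G) c"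
    using outer_inv_exists[of G ?f ?g, OF fg _ fin] by blast
  then show "\<exists>\<rho>. biclique_list_coloring G L \<rho>"
    using biclique_list_coloring_from_invs[OF G r L(1) inv0] by blast
qed

section \<open>Timed total correctness\<close>

definition triple :: "(state \<Rightarrow> bool) \<Rightarrow> com \<Rightarrow> nat \<Rightarrow> (state \<Rightarrow> bool) \<Rightarrow> bool" where
  "triple P c T Q \<longleftrightarrow> (\<forall>s. P s \<longrightarrow> (\<exists>t s'. exec c s t s' \<and> t \<le> T \<and> Q s'))"

lemma tripleE:
  assumes "triple P c T Q" "P s"
  obtains t s' where "exec c s t s'" "t \<le> T" "Q s'"
  using assms unfolding triple_def by blast

lemma triple_conseq:
  assumes "triple P c T Q" "\<And>s. P' s \<Longrightarrow> P s" "\<And>s. Q s \<Longrightarrow> Q' s"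
  shows "triple P' c T Q'"
  using assms unfolding triple_def by metis

lemma triple_Seq:
  assumes "triple P c T Q" "triple Q d U R"
  shows "triple P (Seq c d) (T + U) R"
  unfolding triple_def
proof (intro allI impI)
  fix s assume "P s"
  then obtain t s' where 1: "exec c s t s'" "t \<le> T" "Q s'" using assms(1) unfolding triple_def by blast
  then obtain u s'' where 2: "exec d s' u s''" "u \<le> U" "R s''" using assms(2) unfolding triple_def by blast
  have "exec (Seq c d) s (t + u) s''" using 1(1) 2(1) by (rule exec.Seq)
  moreover have "t + u \<le> T + U" using 1(2) 2(2) by simp
  ultimately show "\<exists>t s'. exec (Seq c d) s t s' \<and> t \<le> T + U \<and> R s'" using 2(3) by blast
qed

primrec loop_free :: "com \<Rightarrow> bool" where
  "loop_free Skip \<longleftrightarrow> True"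
| "loop_free (SetReg r a) \<longleftrightarrow> True"
| "loop_free (SetMem a b) \<longleftrightarrow> True"
| "loop_free (Seq c d) \<longleftrightarrow> loop_free c \<and> loop_free d"
| "loop_free (Cond b c d) \<longleftrightarrow> loop_free c \<and> loop_free d"
| "loop_free (Loop b c) \<longleftrightarrow> False"

text \<open>Functional semantics for loop-free programs, so that straight-line code is verified by
  simplification rather than by derivations in \<open>exec\<close>.\<close>

primrec effect :: "com \<Rightarrow> state \<Rightarrow> state" where
  "effect Skip s = s"
| "effect (SetReg r a) s = s\<lparr>reg := (reg s)(r := aval a s)\<rparr>"
| "effect (SetMem a b) s = s\<lparr>mem := (mem s)(aval a s := aval b s)\<rparr>"
| "effect (Seq c d) s = effect d (effect c s)"
| "effect (Cond b c d) s = (if bval b s then effect c s else effect d s)"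
| "effect (Loop b c) s = s"

text \<open>Independent of the state: both branches of a conditional are charged, which is crude but
  still an upper bound on loop-free code.\<close>

primrec time_bound :: "com \<Rightarrow> nat" where
  "time_bound Skip = 1"
| "time_bound (SetReg r a) = 1 + acost a"
| "time_bound (SetMem a b) = 1 + acost a + acost b"
| "time_bound (Seq c d) = time_bound c + time_bound d"
| "time_bound (Cond b c d) = 1 + bcost b + time_bound c + time_bound d"
| "time_bound (Loop b c) = 0"

lemma exec_loop_free:
  "loop_free c \<Longrightarrow> \<exists>t. exec c s t (effect c s) \<and> t \<le> time_bound c"
proof (induction c arbitrary: s)
  case (Seq c d)
  obtain t u where "exec c s t (effect c s)" "t \<le> time_bound c"
    "exec d (effect c s) u (effect d (effect c s))" "u \<le> time_bound d"
    using Seq by fastforce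
  then show ?case by (intro exI[of _ "t + u"]) (auto intro: exec.Seq)
next
  case (Cond b c d)
  obtain t u where "exec c s t (effect c s)" "t \<le> time_bound c"
    "exec d s u (effect d s)" "u \<le> time_bound d"
    using Cond by fastforce
  then show ?case
    by (intro exI[of _ "1 + bcost b + (if bval b s then t else u)"])
      (auto intro: exec.CondTrue[simplified] exec.CondFalse[simplified])
qed (fastforce intro: exec.intros[simplified])+

lemma triple_loop_free:
  assumes "loop_free c" "\<And>s. P s \<Longrightarrow> Q (effect c s)"
  shows "triple P c (time_bound c) Q"
  using exec_loop_free[OF assms(1)] assms(2) unfolding triple_def by blast

section \<open>Counting loops\<close>

text \<open>Register 7 holds the number \<open>n\<close> of iterations. The machine cannot multiply, so the loop also
  maintains in register \<open>q\<close> the address \<open>1 + k * n\<close> of row \<open>k\<close> of the adjacency matrix.\<close>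

definition for_body :: "nat \<Rightarrow> nat \<Rightarrow> com \<Rightarrow> com" where
  "for_body r q c = Seq c (Seq (SetReg r (Add (Reg r) (Const 1))) (SetReg q (Add (Reg q) (Reg 7))))"

definition for_loop :: "nat \<Rightarrow> nat \<Rightarrow> com \<Rightarrow> com" where
  "for_loop r q c = Seq (Seq (SetReg r (Const 0)) (SetReg q (Const 1)))
     (Loop (Less (Reg r) (Reg 7)) (for_body r q c))"

definition counter :: "nat \<Rightarrow> nat \<Rightarrow> nat \<Rightarrow> nat \<Rightarrow> state \<Rightarrow> bool" where
  "counter n r q k s \<longleftrightarrow> reg s r = k \<and> reg s q = 1 + k * n \<and> reg s 7 = n"

text \<open>\<open>indep\<close> lets the two loop registers change under \<open>J\<close>. Each
  iteration is charged 12 beyond \<open>T\<close>: 4 for the test and 8 for the two increments. The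
  leading 8 is 4 for initialization and 4 for the last, failing test.\<close>

lemma triple_for_loop:
  assumes regs: "r \<noteq> q" "r \<noteq> 7" "q \<noteq> 7"
    and body: "\<And>k. k < n \<Longrightarrow> triple (\<lambda>s. J k s \<and> counter n r q k s) c T
                 (\<lambda>s. J (Suc k) s \<and> counter n r q k s)"
    and indep: "\<And>k s x y. J k s \<Longrightarrow> J k (s\<lparr>reg := (reg s)(r := x, q := y)\<rparr>)"
  shows "triple (\<lambda>s. J 0 s \<and> reg s 7 = n) (for_loop r q c) (8 + n * (T + 12))
           (\<lambda>s. J n s \<and> reg s 7 = n)"
proof -
  let ?b = "Less (Reg r) (Reg 7)" and ?d = "for_body r q c"
  \<comment> \<open>Induction on the number \<open>m\<close> of remaining iterations, with the
    counter \<open>k\<close> generalized.\<close>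
  have loop: "\<exists>t s'. exec (Loop ?b ?d) s t s' \<and> t \<le> 4 + m * (T + 12) \<and> J n s' \<and> reg s' 7 = n"
    if "J k s" "counter n r q k s" "k + m = n" for k s m
    using that
  proof (induction m arbitrary: k s)
    case 0
    then have "\<not> bval ?b s" by (simp add: counter_def)
    from exec.LoopFalse[OF this, of ?d] have "exec (Loop ?b ?d) s 4 s" by (simp add: eval_nat_numeral)
    then show ?case using 0 by (intro exI[of _ 4] exI[of _ s]) (auto simp: counter_def)
  next
    case (Suc m)
    then have b: "bval ?b s" and k: "k < n" by (simp_all add: counter_def)
    obtain t s1 where 1: "exec c s t s1" "t \<le> T" "J (Suc k) s1" "counter n r q k s1"
      using body[OF k] Suc.prems unfolding triple_def by blast
    let ?inc = "Seq (SetReg r (Add (Reg r) (Const 1))) (SetReg q (Add (Reg q) (Reg 7)))"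
    let ?s2 = "s1\<lparr>reg := (reg s1)(r := Suc k, q := 1 + Suc k * n)\<rparr>"
    have eff: "effect ?inc s1 = ?s2" using 1(4) regs by (simp add: counter_def add.commute)
    obtain u where u: "exec ?inc s1 u ?s2" "u \<le> 8"
      using exec_loop_free[of ?inc s1] unfolding eff by auto
    have d: "exec ?d s (t + u) ?s2" unfolding for_body_def using 1(1) u(1) by (rule exec.Seq)
    have J2: "J (Suc k) ?s2" using indep[OF 1(3)] .
    have c2: "counter n r q (Suc k) ?s2" using 1(4) regs by (simp add: counter_def)
    obtain t' s' where 3: "exec (Loop ?b ?d) ?s2 t' s'" "t' \<le> 4 + m * (T + 12)" "J n s'" "reg s' 7 = n"
      using Suc.IH[OF J2 c2] Suc.prems(3) by auto
    have "exec (Loop ?b ?d) s (1 + bcost ?b + (t + u) + t') s'"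
      using b d 3(1) by (rule exec.LoopTrue)
    moreover have "1 + bcost ?b + (t + u) + t' \<le> 4 + Suc m * (T + 12)"
      using 1(2) u(2) 3(2) by simp
    ultimately show ?case using 3(3,4) by blast
  qed
  let ?init = "Seq (SetReg r (Const 0)) (SetReg q (Const 1))"
  have "triple (\<lambda>s. J 0 s \<and> reg s 7 = n) ?init (time_bound ?init) (\<lambda>s. J 0 s \<and> counter n r q 0 s)"
    by (rule triple_loop_free) (use regs indep in \<open>auto simp: counter_def\<close>)
  then have init: "triple (\<lambda>s. J 0 s \<and> reg s 7 = n) ?init 4 (\<lambda>s. J 0 s \<and> counter n r q 0 s)"
    by (simp add: eval_nat_numeral)
  have "triple (\<lambda>s. J 0 s \<and> counter n r q 0 s) (Loop ?b ?d) (4 + n * (T + 12)) (\<lambda>s. J n s \<and> reg s 7 = n)"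
    unfolding triple_def using loop[of 0 _ n] by simp
  from triple_Seq[OF init this] show ?thesis unfolding for_loop_def by simp
qed

text \<open>Registers 0 and 1 hold the end \<open>B\<close> of the input block, where the work space starts.\<close>

definition frame :: "nat \<Rightarrow> nat \<Rightarrow> state \<Rightarrow> bool" where
  "frame n B s \<longleftrightarrow> reg s 0 = B \<and> reg s 1 = B \<and> reg s 7 = n"

text \<open>Registers 5 and 6 point to the matrix rows of \<open>i\<close> and \<open>j\<close>; the
  offset 1 skips the entry \<open>n\<close> at address 0.\<close>

definition at_pair :: "nat \<Rightarrow> nat \<Rightarrow> nat \<Rightarrow> nat \<Rightarrow> state \<Rightarrow> bool" where
  "at_pair n B i j s \<longleftrightarrow> frame n B s \<and> reg s 2 = i \<and> reg s 3 = j \<and>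
     reg s 5 = 1 + i * n \<and> reg s 6 = 1 + j * n"

definition for_pairs :: "com \<Rightarrow> com" where
  "for_pairs c = for_loop 2 5 (for_loop 3 6 c)"

text \<open>Tracks only the set of scanned pairs, and \<open>body\<close> is required for every
  \<open>S\<close>. This is the form of the invariant steps above, which do not refer to the order
  of the scan.\<close>

lemma triple_for_pairs:
  assumes body: "\<And>i j S. i < n \<Longrightarrow> j < n \<Longrightarrow>
      triple (\<lambda>s. at_pair n B i j s \<and> I S (mem s)) c T
             (\<lambda>s. at_pair n B i j s \<and> I (insert (i, j) S) (mem s))"
  shows "triple (\<lambda>s. frame n B s \<and> I {} (mem s)) (for_pairs c)
           (8 + n * (8 + n * (T + 12) + 12))
           (\<lambda>s. frame n B s \<and> I ({..<n} \<times> {..<n}) (mem s))"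
proof -
  let ?J = "\<lambda>i s. frame n B s \<and> I ({..<i} \<times> {..<n}) (mem s)"
  \<comment> \<open>Inside row \<open>i\<close>, the scanned pairs are all earlier rows together
    with the first \<open>j\<close> entries of row \<open>i\<close>.\<close>
  let ?K = "\<lambda>i j s. frame n B s \<and> reg s 2 = i \<and> reg s 5 = 1 + i * n \<and>
    I ({..<i} \<times> {..<n} \<union> {i} \<times> {..<j}) (mem s)"
  have inner: "triple (\<lambda>s. ?J i s \<and> counter n 2 5 i s) (for_loop 3 6 c) (8 + n * (T + 12))
      (\<lambda>s. ?J (Suc i) s \<and> counter n 2 5 i s)" if i: "i < n" for i
  proof -
    have "triple (\<lambda>s. ?K i 0 s \<and> reg s 7 = n) (for_loop 3 6 c) (8 + n * (T + 12))
        (\<lambda>s. ?K i n s \<and> reg s 7 = n)"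
    proof (rule triple_for_loop)
      fix j assume j: "j < n"
      have "insert (i, j) ({..<i} \<times> {..<n} \<union> {i} \<times> {..<j}) = {..<i} \<times> {..<n} \<union> {i} \<times> {..<Suc j}"
        by auto
      with body[OF i j, of "{..<i} \<times> {..<n} \<union> {i} \<times> {..<j}"]
      have "triple (\<lambda>s. at_pair n B i j s \<and> I ({..<i} \<times> {..<n} \<union> {i} \<times> {..<j}) (mem s)) c T
          (\<lambda>s. at_pair n B i j s \<and> I ({..<i} \<times> {..<n} \<union> {i} \<times> {..<Suc j}) (mem s))"
        by simp
      then show "triple (\<lambda>s. ?K i j s \<and> counter n 3 6 j s) c T (\<lambda>s. ?K i (Suc j) s \<and> counter n 3 6 j s)"
        by (rule triple_conseq) (auto simp: at_pair_def counter_def frame_def)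
    qed (auto simp: frame_def)
    moreover have "{..<i} \<times> {..<n} \<union> {i} \<times> {..<n} = {..<Suc i} \<times> {..<n}" by auto
    ultimately show ?thesis
      by (elim triple_conseq) (auto simp: counter_def frame_def)
  qed
  have "triple (\<lambda>s. ?J 0 s \<and> reg s 7 = n) (for_pairs c) (8 + n * (8 + n * (T + 12) + 12))
      (\<lambda>s. ?J n s \<and> reg s 7 = n)"
    unfolding for_pairs_def
    by (rule triple_for_loop[where J = ?J]) (use inner in \<open>auto simp: frame_def\<close>)
  then show ?thesis by (rule triple_conseq) (auto simp: frame_def)
qed

section \<open>The program\<close>

definition color_addr :: "nat \<Rightarrow> aexp" where
  "color_addr x = Add (Reg 1) (Reg x)"

definition dominated_addr :: "nat \<Rightarrow> aexp" where
  "dominated_addr x = Add (Add (Reg 1) (Reg 7)) (Reg x)"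

definition visited_addr :: "nat \<Rightarrow> aexp" where
  "visited_addr x = Add (Add (Add (Reg 1) (Reg 7)) (Reg 7)) (Reg x)"

text \<open>The color lists are the last \<open>2 * n\<close> cells of the input, so counting back
  from its end avoids computing \<open>n * n\<close>.\<close>

definition first_addr :: "nat \<Rightarrow> aexp" where
  "first_addr x = Add (Sub (Sub (Reg 0) (Reg 7)) (Reg 7)) (Add (Reg x) (Reg x))"

definition second_addr :: "nat \<Rightarrow> aexp" where
  "second_addr x = Add (first_addr x) (Const 1)"

lemmas addr_defs = color_addr_def dominated_addr_def visited_addr_def first_addr_def second_addr_def

definition zero :: "aexp \<Rightarrow> bexp" where
  "zero a = Eql a (Const 0)"

text \<open>With column \<open>k\<close> in register 4, register 8 is set on a neighbor of
  \<open>i\<close> that is not one of \<open>j\<close>, and register 9 on the converse.\<close>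

definition compare_body :: com where
  "compare_body =
     Seq (Cond (Conj (Neg (zero (Mem (Add (Reg 5) (Reg 4))))) (zero (Mem (Add (Reg 6) (Reg 4)))))
            (SetReg 8 (Const 1)) Skip)
         (Cond (Conj (Neg (zero (Mem (Add (Reg 6) (Reg 4))))) (zero (Mem (Add (Reg 5) (Reg 4)))))
            (SetReg 9 (Const 1)) Skip)"

definition compare_rows :: com where
  "compare_rows = Seq (Seq (SetReg 8 (Const 0)) (SetReg 9 (Const 0))) (for_loop 4 10 compare_body)"

text \<open>Decides \<open>rdom\<close> for the pair in registers 2 and 3 once
  \<open>compare_rows\<close> has run, with the vertex number as rank.\<close>

definition rdom_test :: bexp where
  "rdom_test = Conj (Neg (Eql (Reg 2) (Reg 3)))
     (Conj (zero (Reg 8)) (Neg (Conj (zero (Reg 9)) (Neg (Less (Reg 3) (Reg 2))))))"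

definition mark_body :: com where
  "mark_body = Cond rdom_test (SetMem (dominated_addr 2) (Const 1)) Skip"

text \<open>In a conflict the second color can be stored without inspecting the list, since an
  unvisited vertex still has its first color.\<close>

definition core_body :: com where
  "core_body =
     Cond (Conj (Neg (zero (Mem (Add (Reg 5) (Reg 3)))))
            (Conj (zero (Mem (dominated_addr 2)))
              (Conj (zero (Mem (dominated_addr 3))) (zero (Mem (visited_addr 3))))))
       (Seq (Cond (Eql (Mem (color_addr 3)) (Mem (color_addr 2)))
              (SetMem (color_addr 3) (Mem (second_addr 3))) Skip)
         (Seq (SetMem (visited_addr 2) (Const 1)) (SetMem (visited_addr 3) (Const 1))))
       Skip"

definition outer_body :: com where
  "outer_body =
     Cond (Conj (zero (Mem (dominated_addr 3))) rdom_test)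
       (Cond (Eql (Mem (color_addr 3)) (Mem (first_addr 2)))
         (SetMem (color_addr 2) (Mem (second_addr 2)))
         (SetMem (color_addr 2) (Mem (first_addr 2))))
       Skip"

definition init_body :: com where
  "init_body = SetMem (color_addr 2) (Mem (first_addr 2))"

definition load_size :: com where
  "load_size = Seq (SetReg 7 (Mem (Const 0))) (SetReg 1 (Reg 0))"

text \<open>The color array starts at the address in register 1, so storing \<open>n\<close> in
  register 0 at the end turns it into the result block.\<close>

definition coloring_program :: com where
  "coloring_program =
     Seq load_size
    (Seq (for_pairs (Seq compare_rows mark_body))
    (Seq (for_loop 2 5 init_body)
    (Seq (for_pairs core_body)
    (Seq (for_pairs (Seq compare_rows outer_body))
         (SetReg 0 (Reg 7))))))"

text \<open>Fixing the memory as \<open>m\<close> records that the comparison changes registers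
  only.\<close>

lemma triple_compare_rows:
  "triple (\<lambda>s. at_pair n B i j s \<and> mem s = m) compare_rows
     (4 + (8 + n * (time_bound compare_body + 12)))
     (\<lambda>s. at_pair n B i j s \<and> mem s = m \<and>
        (reg s 8 = 0 \<longleftrightarrow> (\<forall>k<n. m (Suc (i * n + k)) \<noteq> 0 \<longrightarrow> m (Suc (j * n + k)) \<noteq> 0)) \<and>
        (reg s 9 = 0 \<longleftrightarrow> (\<forall>k<n. m (Suc (j * n + k)) \<noteq> 0 \<longrightarrow> m (Suc (i * n + k)) \<noteq> 0)))"
proof -
  let ?J = "\<lambda>k s. at_pair n B i j s \<and> mem s = m \<and>
    (reg s 8 = 0 \<longleftrightarrow> (\<forall>l<k. m (Suc (i * n + l)) \<noteq> 0 \<longrightarrow> m (Suc (j * n + l)) \<noteq> 0)) \<and>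
    (reg s 9 = 0 \<longleftrightarrow> (\<forall>l<k. m (Suc (j * n + l)) \<noteq> 0 \<longrightarrow> m (Suc (i * n + l)) \<noteq> 0))"
  let ?init = "Seq (SetReg 8 (Const 0)) (SetReg 9 (Const 0))"
  have "triple (\<lambda>s. at_pair n B i j s \<and> mem s = m) ?init (time_bound ?init) (\<lambda>s. ?J 0 s \<and> reg s 7 = n)"
    by (rule triple_loop_free) (auto simp: at_pair_def frame_def)
  then have init: "triple (\<lambda>s. at_pair n B i j s \<and> mem s = m) ?init 4 (\<lambda>s. ?J 0 s \<and> reg s 7 = n)"
    by (simp add: eval_nat_numeral)
  have "triple (\<lambda>s. ?J 0 s \<and> reg s 7 = n) (for_loop 4 10 compare_body)
      (8 + n * (time_bound compare_body + 12)) (\<lambda>s. ?J n s \<and> reg s 7 = n)"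
  proof (rule triple_for_loop)
    fix k assume "k < n"
    show "triple (\<lambda>s. ?J k s \<and> counter n 4 10 k s) compare_body (time_bound compare_body)
        (\<lambda>s. ?J (Suc k) s \<and> counter n 4 10 k s)"
      by (rule triple_loop_free)
        (auto simp: compare_body_def zero_def at_pair_def frame_def counter_def less_Suc_eq)
  qed (auto simp: at_pair_def frame_def)
  from triple_Seq[OF init this] show ?thesis
    unfolding compare_rows_def by (rule triple_conseq) auto
qed

section \<open>Correctness of the program\<close>

lemma length_concat_uniform:
  assumes "\<And>i. i < n \<Longrightarrow> length (h i) = k"
  shows "length (concat (map h [0..<n])) = n * k"
  using assms by (induction n) auto

text \<open>Blocks of common length \<open>k\<close> start at multiples of \<open>k\<close>. Used
  with \<open>k = n\<close> for the matrix and \<open>k = 2\<close> for the color lists.\<close>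

lemma nth_concat_uniform:
  assumes "\<And>i. i < n \<Longrightarrow> length (h i) = k" "i < n" "j < k"
  shows "concat (map h [0..<n]) ! (i * k + j) = h i ! j"
  using assms
proof (induction n)
  case (Suc n)
  have len: "length (concat (map h [0..<n])) = n * k"
    using Suc.prems(1) by (intro length_concat_uniform) auto
  show ?case
  proof (cases "i = n")
    case True
    then show ?thesis using len Suc.prems by (simp add: nth_append)
  next
    case False
    then have i: "i < n" using Suc.prems(2) by simp
    have "i * k + j < Suc i * k" using Suc.prems(3) by simp
    also have "\<dots> \<le> n * k" using i by (intro mult_le_mono1) simp
    finally show ?thesis using len Suc i by (simp add: nth_append)
  qed
qed simp

text \<open>Maximal bicliques consist of vertices, so values elsewhere are irrelevant. This lets the
  result list, meaningful only below \<open>n\<close>, stand for a coloring.\<close>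

lemma biclique_list_coloring_cong:
  assumes "biclique_list_coloring G L c" "\<forall>v \<in> pverts G. c' v = c v"
  shows "biclique_list_coloring G L c'"
proof -
  have "monochromatic c' W \<longleftrightarrow> monochromatic c W" if "maximal_biclique G W" for W
  proof -
    have "W \<subseteq> pverts G" using that unfolding maximal_biclique_def biclique_def by blast
    then have "c' ` W = c ` W" using assms(2) by (intro image_cong) auto
    then show ?thesis unfolding monochromatic_def by simp
  qed
  then show ?thesis using assms unfolding biclique_list_coloring_def list_coloring_def by auto
qed

definition pairs_time :: "nat \<Rightarrow> nat \<Rightarrow> nat" where
  "pairs_time n T = 8 + n * (8 + n * (T + 12) + 12)"

definition compare_time :: "nat \<Rightarrow> nat" where
  "compare_time n = 4 + (8 + n * (time_bound compare_body + 12))"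

definition total_time :: "nat \<Rightarrow> nat" where
  "total_time n = time_bound load_size +
     (pairs_time n (compare_time n + time_bound mark_body) +
     ((8 + n * (time_bound init_body + 12)) +
     (pairs_time n (time_bound core_body) +
     (pairs_time n (compare_time n + time_bound outer_body) + 2))))"

section \<open>A fixed instance and its layout in memory\<close>

locale list_instance =
  fixes G :: "nat pair_pre_digraph" and L :: "nat \<Rightarrow> nat set" and n :: nat
  assumes graph: "pair_graph G" and verts: "pverts G = {..<n}" and lists: "list_assignment 2 G L"
begin

definition f where "f v = Min (L v)"
definition g where "g v = Max (L v)"
definition input where "input = encode_instance (G, L)"
text \<open>One cell for \<open>n\<close>, then the matrix, then two colors per vertex.\<close>

definition B where "B = Suc (n * n + (n + n))"

lemma L_eq: "v \<in> pverts G \<Longrightarrow> L v = {f v, g v}"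
  unfolding f_def g_def by (rule list_assignment_2_pair[OF lists])

lemma f_less_g: "v \<in> pverts G \<Longrightarrow> f v < g v"
  unfolding f_def g_def by (rule list_assignment_2_pair[OF lists])

lemma f_neq_g: "v \<in> pverts G \<Longrightarrow> f v \<noteq> g v"
  using f_less_g by fastforce

definition matrix where
  "matrix = concat (map (\<lambda>i. map (\<lambda>j. if (i, j) \<in> parcs G then 1 else (0::nat)) [0..<n]) [0..<n])"

definition color_lists where
  "color_lists = concat (map (\<lambda>i. sorted_list_of_set (L i)) [0..<n])"

lemma sorted_L: "i < n \<Longrightarrow> sorted_list_of_set (L i) = [f i, g i]"
  using f_less_g[of i] L_eq[of i] verts by simp

lemma input_eq: "input = n # matrix @ color_lists"
  unfolding input_def encode_instance_def matrix_def color_lists_def Let_def using verts by simp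

lemma length_matrix: "length matrix = n * n"
  unfolding matrix_def by (rule length_concat_uniform) simp

lemma length_input: "length input = B"
proof -
  have "length color_lists = n * 2"
    unfolding color_lists_def by (rule length_concat_uniform) (simp add: sorted_L)
  then show ?thesis using length_matrix unfolding input_eq B_def by simp
qed

lemma row_bound: "i < n \<Longrightarrow> j < n \<Longrightarrow> i * n + j < n * n"
proof -
  assume "i < n" "j < n"
  then have "i * n + j < Suc i * n" by simp
  also have "\<dots> \<le> n * n" using \<open>i < n\<close> by (intro mult_le_mono1) simp
  finally show ?thesis .
qed

lemma input_arc:
  assumes "i < n" "j < n"
  shows "input ! Suc (i * n + j) = (if (i, j) \<in> parcs G then 1 else 0)"
proof -
  have "matrix ! (i * n + j) = map (\<lambda>j. if (i, j) \<in> parcs G then 1 else (0::nat)) [0..<n] ! j"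
    unfolding matrix_def using assms by (intro nth_concat_uniform) auto
  then show ?thesis
    using row_bound[OF assms] length_matrix assms by (simp add: input_eq nth_append)
qed

lemma input_colors:
  assumes "i < n"
  shows "input ! Suc (n * n + (i + i)) = f i" "input ! Suc (Suc (n * n + (i + i))) = g i"
proof -
  have "color_lists ! (i * 2 + j) = sorted_list_of_set (L i) ! j" if "j < 2" for j
    unfolding color_lists_def using assms that by (intro nth_concat_uniform) (auto simp: sorted_L)
  from this[of 0] this[of 1] have "color_lists ! (i + i) = f i" "color_lists ! Suc (i + i) = g i"
    using assms by (simp_all add: sorted_L mult_2_right)
  then show "input ! Suc (n * n + (i + i)) = f i" "input ! Suc (Suc (n * n + (i + i))) = g i"
    using length_matrix by (simp_all add: input_eq nth_append)
qed

text \<open>The work space consists of three arrays of length \<open>n\<close>: colors, marks of dominated vertices,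
  and marks of visited vertices.\<close>

definition holds :: "(nat \<Rightarrow> nat) \<Rightarrow> (nat \<Rightarrow> nat) \<Rightarrow> (nat \<Rightarrow> nat) \<Rightarrow> (nat \<Rightarrow> nat) \<Rightarrow> bool" where
  "holds m c d e \<longleftrightarrow> (\<forall>a<B. m a = input ! a) \<and>
     (\<forall>i<n. m (B + i) = c i \<and> m (B + n + i) = d i \<and> m (B + n + n + i) = e i)"

lemma holds_read:
  assumes "holds m c d e" "i < n"
  shows "m (B + i) = c i" "m (B + n + i) = d i" "m (B + n + n + i) = e i"
    "m (B - n - n + (i + i)) = f i" "m (Suc (B - n - n + (i + i))) = g i"
    "j < n \<Longrightarrow> m (Suc (i * n + j)) = (if (i, j) \<in> parcs G then 1 else 0)"
proof -
  show "m (B + i) = c i" "m (B + n + i) = d i" "m (B + n + n + i) = e i"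
    using assms unfolding holds_def by auto
  have in_input: "m a = input ! a" if "a < B" for a using assms(1) that unfolding holds_def by blast
  \<comment> \<open>Truncated subtraction is exact here because \<open>B\<close> has
    \<open>n + n\<close> as a summand.\<close>
  have "B - n - n + (i + i) = Suc (n * n + (i + i))" unfolding B_def by simp
  moreover have "Suc (Suc (n * n + (i + i))) < B" using assms(2) unfolding B_def by simp
  ultimately show "m (B - n - n + (i + i)) = f i" "m (Suc (B - n - n + (i + i))) = g i"
    using in_input input_colors[OF assms(2)] by simp_all
  show "m (Suc (i * n + j)) = (if (i, j) \<in> parcs G then 1 else 0)" if "j < n"
  proof -
    have "Suc (i * n + j) < B" using row_bound[OF assms(2) that] unfolding B_def by simp
    then show ?thesis using in_input input_arc[OF assms(2) that] by simp
  qed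
qed

text \<open>The bound \<open>i < n\<close> keeps a write inside its own array, away from the other
  two and from the input.\<close>

lemma holds_write:
  assumes "holds m c d e" "i < n"
  shows "holds (m(B + i := x)) (c(i := x)) d e"
    "holds (m(B + n + i := x)) c (d(i := x)) e"
    "holds (m(B + n + n + i := x)) c d (e(i := x))"
  using assms unfolding holds_def by auto

lemma holds_cong:
  assumes "holds m c d e" "\<And>i. i < n \<Longrightarrow> c i = c' i"
  shows "holds m c' d e"
  using assms unfolding holds_def by auto

text \<open>Vertices are numbers here, so the identity serves as the injective rank.\<close>

abbreviation "Core \<equiv> core G id"
abbreviation "Rdom \<equiv> rdom G id"

definition marks :: "(nat \<Rightarrow> nat) \<Rightarrow> (nat \<times> nat) set \<Rightarrow> bool" where
  "marks d S \<longleftrightarrow> (\<forall>i<n. d i = 0 \<longleftrightarrow> \<not> (\<exists>j. (i, j) \<in> S \<and> Rdom i j))"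

lemma marks_all:
  assumes "marks d ({..<n} \<times> {..<n})" "i < n"
  shows "d i = 0 \<longleftrightarrow> i \<in> Core"
  using assms verts unfolding marks_def core_def rdom_def by auto

lemma nbhd_subset_iff:
  "nbhd G i \<subseteq> nbhd G j \<longleftrightarrow> (\<forall>k<n. (i, k) \<in> parcs G \<longrightarrow> (j, k) \<in> parcs G)"
  using pair_graph_arcD(2)[OF graph] verts unfolding nbhd_def by auto

text \<open>The comparison leaves the memory alone, so it preserves any \<open>I\<close>; that
  \<open>I\<close> entails \<open>holds\<close> is what identifies the compared cells with adjacency
  rows.\<close>

lemma triple_compare_rdom:
  assumes ij: "i < n" "j < n" and I: "\<And>m. I m \<Longrightarrow> \<exists>c d e. holds m c d e"
  shows "triple (\<lambda>s. at_pair n B i j s \<and> I (mem s)) compare_rows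
     (4 + (8 + n * (time_bound compare_body + 12)))
     (\<lambda>s. at_pair n B i j s \<and> I (mem s) \<and> (bval rdom_test s \<longleftrightarrow> Rdom i j))"
  unfolding triple_def
proof (intro allI impI)
  fix s assume s: "at_pair n B i j s \<and> I (mem s)"
  let ?m = "mem s"
  obtain c d e where m: "holds ?m c d e" using s I by blast
  \<comment> \<open>The trivial equation instantiates the fixed memory of
    \<open>triple_compare_rows\<close> by that of \<open>s\<close>.\<close>
  have "at_pair n B i j s \<and> ?m = ?m" using s by simp
  with triple_compare_rows[of n B i j ?m] obtain t s' where
    run: "exec compare_rows s t s'" "t \<le> 4 + (8 + n * (time_bound compare_body + 12))" and
    post: "at_pair n B i j s' \<and> mem s' = ?m \<and>
      (reg s' 8 = 0 \<longleftrightarrow> (\<forall>k<n. ?m (Suc (i * n + k)) \<noteq> 0 \<longrightarrow> ?m (Suc (j * n + k)) \<noteq> 0)) \<and>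
      (reg s' 9 = 0 \<longleftrightarrow> (\<forall>k<n. ?m (Suc (j * n + k)) \<noteq> 0 \<longrightarrow> ?m (Suc (i * n + k)) \<noteq> 0))"
    by (rule tripleE)
  have s': "at_pair n B i j s'" "mem s' = ?m"
    "reg s' 8 = 0 \<longleftrightarrow> (\<forall>k<n. ?m (Suc (i * n + k)) \<noteq> 0 \<longrightarrow> ?m (Suc (j * n + k)) \<noteq> 0)"
    "reg s' 9 = 0 \<longleftrightarrow> (\<forall>k<n. ?m (Suc (j * n + k)) \<noteq> 0 \<longrightarrow> ?m (Suc (i * n + k)) \<noteq> 0)"
    using post by blast+
  have "reg s' 8 = 0 \<longleftrightarrow> nbhd G i \<subseteq> nbhd G j" "reg s' 9 = 0 \<longleftrightarrow> nbhd G j \<subseteq> nbhd G i"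
    unfolding s'(3,4) nbhd_subset_iff
    using holds_read(6)[OF m ij(1)] holds_read(6)[OF m ij(2)] by auto
  then have "bval rdom_test s' \<longleftrightarrow> Rdom i j"
    using s'(1) ij verts unfolding rdom_test_def zero_def at_pair_def rdom_def by auto
  then show "\<exists>t s'. exec compare_rows s t s' \<and> t \<le> 4 + (8 + n * (time_bound compare_body + 12)) \<and>
      at_pair n B i j s' \<and> I (mem s') \<and> (bval rdom_test s' \<longleftrightarrow> Rdom i j)"
    using run s'(1,2) s by (intro exI[of _ t] exI[of _ s']) simp
qed

section \<open>Verification of the stages of the program\<close>

text \<open>Colors are still arbitrary, but the visited array is kept at zero, as the core scan
  starts with every vertex unvisited.\<close>

definition mark_inv where
  "mark_inv S m \<longleftrightarrow> (\<exists>c d. holds m c d (\<lambda>_. 0) \<and> marks d S)"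

definition stage_core where
  "stage_core S m \<longleftrightarrow>
     (\<exists>c d e. holds m c d e \<and> marks d ({..<n} \<times> {..<n}) \<and> core_inv G id f g S c e)"

definition stage_outer where
  "stage_outer c0 S m \<longleftrightarrow>
     (\<exists>c d e. holds m c d e \<and> marks d ({..<n} \<times> {..<n}) \<and> outer_inv G id f g c0 S c)"

lemma triple_mark:
  "triple (\<lambda>s. frame n B s \<and> mark_inv {} (mem s)) (for_pairs (Seq compare_rows mark_body))
     (pairs_time n (compare_time n + time_bound mark_body))
     (\<lambda>s. frame n B s \<and> mark_inv ({..<n} \<times> {..<n}) (mem s))"
  unfolding pairs_time_def
proof (rule triple_for_pairs)
  fix i j S assume ij: "i < n" "j < n"
  show "triple (\<lambda>s. at_pair n B i j s \<and> mark_inv S (mem s)) (Seq compare_rows mark_body)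
      (compare_time n + time_bound mark_body)
      (\<lambda>s. at_pair n B i j s \<and> mark_inv (insert (i, j) S) (mem s))"
  proof (rule triple_Seq)
    show "triple (\<lambda>s. at_pair n B i j s \<and> mark_inv S (mem s)) compare_rows (compare_time n)
        (\<lambda>s. at_pair n B i j s \<and> mark_inv S (mem s) \<and> (bval rdom_test s \<longleftrightarrow> Rdom i j))"
      unfolding compare_time_def by (rule triple_compare_rdom[OF ij]) (auto simp: mark_inv_def)
    show "triple (\<lambda>s. at_pair n B i j s \<and> mark_inv S (mem s) \<and> (bval rdom_test s \<longleftrightarrow> Rdom i j))
        mark_body (time_bound mark_body)
        (\<lambda>s. at_pair n B i j s \<and> mark_inv (insert (i, j) S) (mem s))"
    proof (rule triple_loop_free)
      fix s assume s: "at_pair n B i j s \<and> mark_inv S (mem s) \<and> (bval rdom_test s \<longleftrightarrow> Rdom i j)"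
      then obtain c d where cd: "holds (mem s) c d (\<lambda>_. 0)" "marks d S" unfolding mark_inv_def by blast
      show "at_pair n B i j (effect mark_body s) \<and> mark_inv (insert (i, j) S) (mem (effect mark_body s))"
      proof (cases "Rdom i j")
        case True
        have "marks (d(i := 1)) (insert (i, j) S)" using cd(2) True unfolding marks_def by auto
        then show ?thesis
          using True s holds_write(2)[OF cd(1) ij(1), of 1] unfolding mark_body_def mark_inv_def
          by (auto simp: at_pair_def frame_def addr_defs)
      next
        case False
        then have "marks d (insert (i, j) S)" using cd(2) unfolding marks_def by auto
        then show ?thesis using False s cd(1) unfolding mark_body_def mark_inv_def by auto
      qed
    qed (simp add: mark_body_def)
  qed
qed

lemma triple_init:
  "triple (\<lambda>s. frame n B s \<and> mark_inv ({..<n} \<times> {..<n}) (mem s)) (for_loop 2 5 init_body)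
     (8 + n * (time_bound init_body + 12))
     (\<lambda>s. frame n B s \<and> stage_core {} (mem s))"
proof -
  let ?J = "\<lambda>k s. frame n B s \<and>
    (\<exists>c d. holds (mem s) c d (\<lambda>_. 0) \<and> marks d ({..<n} \<times> {..<n}) \<and> (\<forall>i<k. c i = f i))"
  have "triple (\<lambda>s. ?J 0 s \<and> reg s 7 = n) (for_loop 2 5 init_body)
      (8 + n * (time_bound init_body + 12)) (\<lambda>s. ?J n s \<and> reg s 7 = n)"
  proof (rule triple_for_loop)
    fix k assume k: "k < n"
    show "triple (\<lambda>s. ?J k s \<and> counter n 2 5 k s) init_body (time_bound init_body)
        (\<lambda>s. ?J (Suc k) s \<and> counter n 2 5 k s)"
    proof (rule triple_loop_free)
      fix s assume s: "?J k s \<and> counter n 2 5 k s"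
      then obtain c d where cd: "holds (mem s) c d (\<lambda>_. 0)" "marks d ({..<n} \<times> {..<n})" "\<forall>i<k. c i = f i"
        by blast
      have "holds ((mem s)(B + k := f k)) (c(k := f k)) d (\<lambda>_. 0)" "\<forall>i<Suc k. (c(k := f k)) i = f i"
        using holds_write(1)[OF cd(1) k] cd(3) by auto
      moreover have "mem (effect init_body s) = (mem s)(B + k := f k)" "reg (effect init_body s) = reg s"
        using s holds_read(4)[OF cd(1) k] by (auto simp: init_body_def addr_defs frame_def counter_def)
      ultimately show "?J (Suc k) (effect init_body s) \<and> counter n 2 5 k (effect init_body s)"
        using s cd(2) unfolding frame_def counter_def by metis
    qed (simp add: init_body_def)
  qed (auto simp: frame_def)
  then show ?thesis
  proof (rule triple_conseq)
    \<comment> \<open>The color array now agrees with \<open>f\<close> below \<open>n\<close>, so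
      \<open>holds_cong\<close> replaces it by \<open>f\<close> itself, for which
      \<open>core_inv_init\<close> holds.\<close>
    fix s assume "?J n s \<and> reg s 7 = n"
    then show "frame n B s \<and> stage_core {} (mem s)"
      unfolding stage_core_def using holds_cong core_inv_init by metis
  qed (auto simp: mark_inv_def frame_def)
qed

lemma triple_core:
  "triple (\<lambda>s. frame n B s \<and> stage_core {} (mem s)) (for_pairs core_body)
     (pairs_time n (time_bound core_body))
     (\<lambda>s. frame n B s \<and> stage_core ({..<n} \<times> {..<n}) (mem s))"
  unfolding pairs_time_def
proof (rule triple_for_pairs)
  fix i j S assume ij: "i < n" "j < n"
  show "triple (\<lambda>s. at_pair n B i j s \<and> stage_core S (mem s)) core_body (time_bound core_body)
      (\<lambda>s. at_pair n B i j s \<and> stage_core (insert (i, j) S) (mem s))"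
  proof (rule triple_loop_free)
    fix s assume s: "at_pair n B i j s \<and> stage_core S (mem s)"
    let ?m = "mem s"
    obtain c d e where cde: "holds ?m c d e" "marks d ({..<n} \<times> {..<n})" "core_inv G id f g S c e"
      using s unfolding stage_core_def by blast
    note read = holds_read[OF cde(1) ij(1)] holds_read[OF cde(1) ij(2)]
      marks_all[OF cde(2) ij(1)] marks_all[OF cde(2) ij(2)]
    have regs: "reg s 0 = B" "reg s 1 = B" "reg s 7 = n" "reg s 2 = i" "reg s 3 = j" "reg s 5 = Suc (i * n)"
      using s unfolding at_pair_def frame_def by auto
    show "at_pair n B i j (effect core_body s) \<and> stage_core (insert (i, j) S) (mem (effect core_body s))"
    proof (cases "(i, j) \<in> parcs G \<and> i \<in> Core \<and> j \<in> Core \<and> e j = 0")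
      case True
      let ?m1 = "?m(B + j := if c j = c i then g j else c j)"
      let ?m3 = "?m1(B + n + n + i := 1, B + n + n + j := 1)"
      \<comment> \<open>Without a conflict the program skips the write. Writing back
        \<open>c j\<close> gives the same memory, so both cases become one update that
        \<open>holds_write\<close> covers.\<close>
      have m1: "(if c j = c i then ?m(B + j := g j) else ?m) = ?m1"
        using holds_read(1)[OF cde(1) ij(2)] by auto
      have "mem (effect core_body s) = ?m3" "reg (effect core_body s) = reg s"
        using True ij regs read unfolding m1[symmetric] by (auto simp: core_body_def zero_def addr_defs)
      moreover have "holds ?m3 (c(j := if c j = c i then g j else c j)) d (e(i := 1, j := 1))"
        using ij cde(1) by (intro holds_write)
      moreover have "core_inv G id f g (insert (i, j) S)
          (c(j := if c j = c i then g j else c j)) (e(i := 1, j := 1))"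
        using core_inv_step[OF graph f_neq_g cde(3)] True by blast
      ultimately show ?thesis
        using s cde(2) unfolding stage_core_def at_pair_def frame_def by metis
    next
      case False
      then have "effect core_body s = s"
        using ij regs read by (auto simp: core_body_def zero_def addr_defs)
      moreover have "stage_core (insert (i, j) S) ?m"
        unfolding stage_core_def using cde(1,2) core_inv_skip[OF cde(3) False] by blast
      ultimately show ?thesis using s by metis
    qed
  qed (simp add: core_body_def)
qed

lemma triple_outer:
  "triple (\<lambda>s. frame n B s \<and> stage_outer c0 {} (mem s)) (for_pairs (Seq compare_rows outer_body))
     (pairs_time n (compare_time n + time_bound outer_body))
     (\<lambda>s. frame n B s \<and> stage_outer c0 ({..<n} \<times> {..<n}) (mem s))"
  unfolding pairs_time_def
proof (rule triple_for_pairs)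
  fix i j S assume ij: "i < n" "j < n"
  show "triple (\<lambda>s. at_pair n B i j s \<and> stage_outer c0 S (mem s)) (Seq compare_rows outer_body)
      (compare_time n + time_bound outer_body)
      (\<lambda>s. at_pair n B i j s \<and> stage_outer c0 (insert (i, j) S) (mem s))"
  proof (rule triple_Seq)
    show "triple (\<lambda>s. at_pair n B i j s \<and> stage_outer c0 S (mem s)) compare_rows (compare_time n)
        (\<lambda>s. at_pair n B i j s \<and> stage_outer c0 S (mem s) \<and> (bval rdom_test s \<longleftrightarrow> Rdom i j))"
      unfolding compare_time_def by (rule triple_compare_rdom[OF ij]) (auto simp: stage_outer_def)
    show "triple (\<lambda>s. at_pair n B i j s \<and> stage_outer c0 S (mem s) \<and> (bval rdom_test s \<longleftrightarrow> Rdom i j))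
        outer_body (time_bound outer_body)
        (\<lambda>s. at_pair n B i j s \<and> stage_outer c0 (insert (i, j) S) (mem s))"
    proof (rule triple_loop_free)
      fix s assume s: "at_pair n B i j s \<and> stage_outer c0 S (mem s) \<and> (bval rdom_test s \<longleftrightarrow> Rdom i j)"
      let ?m = "mem s"
      obtain c d e where cde: "holds ?m c d e" "marks d ({..<n} \<times> {..<n})" "outer_inv G id f g c0 S c"
        using s unfolding stage_outer_def by blast
      note read = holds_read[OF cde(1) ij(1)] holds_read[OF cde(1) ij(2)]
        marks_all[OF cde(2) ij(1)] marks_all[OF cde(2) ij(2)]
      have regs: "reg s 0 = B" "reg s 1 = B" "reg s 7 = n" "reg s 2 = i" "reg s 3 = j"
        using s unfolding at_pair_def frame_def by auto
      show "at_pair n B i j (effect outer_body s) \<and>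
          stage_outer c0 (insert (i, j) S) (mem (effect outer_body s))"
      proof (cases "j \<in> Core \<and> Rdom i j")
        case True
        let ?x = "if c j = f i then g i else f i"
        have "mem (effect outer_body s) = ?m(B + i := ?x)" "reg (effect outer_body s) = reg s"
          using True s regs read by (auto simp: outer_body_def zero_def addr_defs)
        moreover have "holds (?m(B + i := ?x)) (c(i := ?x)) d e"
          using ij cde(1) by (intro holds_write)
        moreover have "outer_inv G id f g c0 (insert (i, j) S) (c(i := ?x))"
          using outer_inv_step[OF f_neq_g cde(3)] True by blast
        ultimately show ?thesis
          using s cde(2) unfolding stage_outer_def at_pair_def frame_def by metis
      next
        case False
        then have "effect outer_body s = s"
          using s regs read by (auto simp: outer_body_def zero_def addr_defs)
        moreover have "stage_outer c0 (insert (i, j) S) ?m"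
          unfolding stage_outer_def using cde(1,2) outer_inv_skip[OF cde(3) False] by blast
        ultimately show ?thesis using s by metis
      qed
    qed (simp add: outer_body_def)
  qed
qed


lemma triple_program:
  "triple (\<lambda>s. s = initial_state input) coloring_program (total_time n)
     (\<lambda>s. reg s 0 = n \<and> reg s 1 = B \<and>
        (\<exists>c0 e. core_inv G id f g ({..<n} \<times> {..<n}) c0 e \<and>
           stage_outer c0 ({..<n} \<times> {..<n}) (mem s)))"
  unfolding coloring_program_def total_time_def
proof (rule triple_Seq[OF _ triple_Seq[OF triple_mark triple_Seq[OF triple_init triple_Seq[OF triple_core]]]])
  show "triple (\<lambda>s. s = initial_state input) load_size (time_bound load_size)
      (\<lambda>s. frame n B s \<and> mark_inv {} (mem s))"
  proof (rule triple_loop_free)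
    fix s assume s: "s = initial_state input"
    have "input ! 0 = n" "B > 0" by (simp_all add: input_eq B_def)
    then have "frame n B (effect load_size s)" "mem (effect load_size s) = mem s"
      using s by (auto simp: load_size_def frame_def initial_state_def length_input)
    \<comment> \<open>Cells beyond the input are initially 0, so all three arrays start as
      zero.\<close>
    moreover have "holds (mem s) (\<lambda>_. 0) (\<lambda>_. 0) (\<lambda>_. 0)"
      unfolding holds_def s by (simp add: initial_state_def length_input)
    then have "mark_inv {} (mem s)" unfolding mark_inv_def marks_def by auto
    ultimately show "frame n B (effect load_size s) \<and> mark_inv {} (mem (effect load_size s))" by simp
  qed (simp add: load_size_def)
  let ?Q = "\<lambda>s. \<exists>c0 e. core_inv G id f g ({..<n} \<times> {..<n}) c0 e \<and>
    stage_outer c0 ({..<n} \<times> {..<n}) (mem s)"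
  show "triple (\<lambda>s. frame n B s \<and> stage_core ({..<n} \<times> {..<n}) (mem s))
      (Seq (for_pairs (Seq compare_rows outer_body)) (SetReg 0 (Reg 7)))
      (pairs_time n (compare_time n + time_bound outer_body) + 2)
      (\<lambda>s. reg s 0 = n \<and> reg s 1 = B \<and> ?Q s)"
  proof (rule triple_Seq)
    show "triple (\<lambda>s. frame n B s \<and> stage_core ({..<n} \<times> {..<n}) (mem s))
        (for_pairs (Seq compare_rows outer_body)) (pairs_time n (compare_time n + time_bound outer_body))
        (\<lambda>s. frame n B s \<and> ?Q s)"
      unfolding triple_def
    proof (intro allI impI)
      \<comment> \<open>The coloring \<open>c0\<close> is read off from the state reached after the
        core scan, and \<open>triple_outer\<close> is then instantiated with it.\<close>
      fix s assume s: "frame n B s \<and> stage_core ({..<n} \<times> {..<n}) (mem s)"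
      then obtain c0 d e where c0: "holds (mem s) c0 d e" "marks d ({..<n} \<times> {..<n})"
        "core_inv G id f g ({..<n} \<times> {..<n}) c0 e" unfolding stage_core_def by blast
      have "outer_inv G id f g c0 {} c0"
        using c0(3) unfolding core_inv_def by (intro outer_inv_init) blast
      then have "frame n B s \<and> stage_outer c0 {} (mem s)" using s c0 unfolding stage_outer_def by blast
      with triple_outer obtain t s' where "exec (for_pairs (Seq compare_rows outer_body)) s t s'"
        "t \<le> pairs_time n (compare_time n + time_bound outer_body)"
        "frame n B s' \<and> stage_outer c0 ({..<n} \<times> {..<n}) (mem s')"
        by (rule tripleE)
      then show "\<exists>t s'. exec (for_pairs (Seq compare_rows outer_body)) s t s' \<and>
          t \<le> pairs_time n (compare_time n + time_bound outer_body) \<and> frame n B s' \<and> ?Q s'"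
        using c0(3) by blast
    qed
    have "triple (\<lambda>s. frame n B s \<and> ?Q s) (SetReg 0 (Reg 7)) (time_bound (SetReg 0 (Reg 7)))
        (\<lambda>s. reg s 0 = n \<and> reg s 1 = B \<and> ?Q s)"
      by (rule triple_loop_free) (auto simp: frame_def)
    then show "triple (\<lambda>s. frame n B s \<and> ?Q s) (SetReg 0 (Reg 7)) 2
        (\<lambda>s. reg s 0 = n \<and> reg s 1 = B \<and> ?Q s)"
      by (simp add: eval_nat_numeral)
  qed
qed

lemma program_correct:
  assumes "K3_free G" "biclique_dominated G"
  shows "\<exists>t s. exec coloring_program (initial_state (encode_instance (G, L))) t s \<and> t \<le> total_time n \<and>
    length (result s) = n \<and> encodes_biclique_list_coloring (G, L) (result s)"
proof -
  obtain t s where run: "exec coloring_program (initial_state input) t s" "t \<le> total_time n"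
    and post: "reg s 0 = n \<and> reg s 1 = B \<and>
        (\<exists>c0 e. core_inv G id f g ({..<n} \<times> {..<n}) c0 e \<and>
           stage_outer c0 ({..<n} \<times> {..<n}) (mem s))"
    using triple_program refl by (rule tripleE)
  then obtain c0 e0 c d e where inv: "core_inv G id f g ({..<n} \<times> {..<n}) c0 e0"
    "holds (mem s) c d e" "outer_inv G id f g c0 ({..<n} \<times> {..<n}) c"
    unfolding stage_outer_def by blast
  have "biclique_list_coloring G L c"
    by (rule biclique_list_coloring_from_invs[where r = id and f = f and g = g])
      (use graph assms L_eq inv verts in simp_all)
  moreover have res: "result s = map c [0..<n]"
  proof (rule nth_equalityI)
    fix i assume "i < length (result s)"
    then show "result s ! i = map c [0..<n] ! i"
      using post holds_read(1)[OF inv(2)] by (simp add: result_def)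
  qed (use post in \<open>simp add: result_def\<close>)
  then have "\<forall>v \<in> pverts G. result s ! v = c v" using verts by simp
  ultimately have "biclique_list_coloring G L (\<lambda>v. result s ! v)"
    using biclique_list_coloring_cong by blast
  then have "encodes_biclique_list_coloring (G, L) (result s)"
    unfolding encodes_biclique_list_coloring_def using res verts by simp
  then show ?thesis using run res unfolding input_def by (intro exI[of _ t] exI[of _ s]) simp
qed

text \<open>Every entry contributes at least 1 to \<open>bit_size\<close>, and the input has
  \<open>B \<ge> n\<close> entries.\<close>

lemma n_le_bit_size: "n \<le> bit_size (encode_instance (G, L))"
proof -
  have "length xs \<le> bit_size xs" for xs by (induction xs) (auto simp: bit_size_def)
  from this[of input] show ?thesis unfolding length_input unfolding input_def B_def by simp
qed

end

section \<open>Polynomial bounds\<close>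

definition is_polynomial :: "(nat \<Rightarrow> nat) \<Rightarrow> bool" where
  "is_polynomial F \<longleftrightarrow> (\<exists>q :: nat poly. \<forall>n. F n = poly q n)"

lemma is_polynomial_intros:
  "is_polynomial (\<lambda>n. k)"
  "is_polynomial (\<lambda>n. n)"
  "is_polynomial F \<Longrightarrow> is_polynomial H \<Longrightarrow> is_polynomial (\<lambda>n. F n + H n)"
  "is_polynomial F \<Longrightarrow> is_polynomial H \<Longrightarrow> is_polynomial (\<lambda>n. F n * H n)"
proof -
  show "is_polynomial (\<lambda>n. k)" unfolding is_polynomial_def by (intro exI[of _ "[:k:]"]) simp
  show "is_polynomial (\<lambda>n. n)" unfolding is_polynomial_def by (intro exI[of _ "[:0, 1:]"]) simp
  show "is_polynomial (\<lambda>n. F n + H n)" if "is_polynomial F" "is_polynomial H"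
    using that unfolding is_polynomial_def by (metis poly_add)
  show "is_polynomial (\<lambda>n. F n * H n)" if "is_polynomial F" "is_polynomial H"
    using that unfolding is_polynomial_def by (metis poly_mult)
qed

text \<open>Natural coefficients are nonnegative. This carries a bound in \<open>n\<close> over to
  the bit size of the input.\<close>

lemma poly_nat_mono: "x \<le> y \<Longrightarrow> poly q x \<le> poly (q :: nat poly) y"
  by (induction q) (auto intro: add_mono mult_mono)

lemma is_polynomial_total_time: "is_polynomial (\<lambda>n. total_time n + n)"
  unfolding total_time_def pairs_time_def compare_time_def
  by (intro is_polynomial_intros)

theorem theorem17:
  shows "(\<forall>G :: 'a pair_pre_digraph.
            pair_graph G \<and> K3_free G \<and> biclique_dominated G \<longrightarrow> biclique_choosable 2 G) \<and>
         poly_time_solvable encode_instance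
           {(G :: nat pair_pre_digraph, L :: nat \<Rightarrow> nat set).
              pair_graph G \<and> pverts G = {..<card (pverts G)} \<and>
              K3_free G \<and> biclique_dominated G \<and> list_assignment 2 G L}
           encodes_biclique_list_coloring"
proof
  show "\<forall>G :: 'a pair_pre_digraph.
      pair_graph G \<and> K3_free G \<and> biclique_dominated G \<longrightarrow> biclique_choosable 2 G"
    using biclique_dominated_choosable by blast
  \<comment> \<open>One polynomial serves all instances, as \<open>total_time\<close> depends on the
    number of vertices only; the summand \<open>n\<close> pays for the length of the result.\<close>
  obtain q :: "nat poly" where q: "\<And>n. total_time n + n = poly q n"
    using is_polynomial_total_time unfolding is_polynomial_def by blast
  have "\<exists>t s. exec coloring_program (initial_state (encode_instance (G, L))) t s \<and>
      t + length (result s) \<le> poly q (bit_size (encode_instance (G, L))) \<and>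
      encodes_biclique_list_coloring (G, L) (result s)"
    if G: "pair_graph G" "pverts G = {..<card (pverts G)}" "K3_free G" "biclique_dominated G"
      "list_assignment 2 G L" for G L
  proof -
    let ?n = "card (pverts G)"
    interpret list_instance G L ?n using G by (intro list_instance.intro)
    obtain t s where ts: "exec coloring_program (initial_state (encode_instance (G, L))) t s"
      "t \<le> total_time ?n" "length (result s) = ?n" "encodes_biclique_list_coloring (G, L) (result s)"
      using program_correct[OF G(3,4)] by blast
    have "t + length (result s) \<le> poly q ?n" using ts(2,3) q[of ?n] by simp
    also have "\<dots> \<le> poly q (bit_size (encode_instance (G, L)))"
      using n_le_bit_size by (rule poly_nat_mono)
    finally show ?thesis using ts(1,4) by blast
  qed
  then show "poly_time_solvable encode_instance
           {(G :: nat pair_pre_digraph, L :: nat \<Rightarrow> nat set).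
              pair_graph G \<and> pverts G = {..<card (pverts G)} \<and>
              K3_free G \<and> biclique_dominated G \<and> list_assignment 2 G L}
           encodes_biclique_list_coloring"
    unfolding poly_time_solvable_def by blast
qed

end
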